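(* Let $n\ge1$ and let $(Q,\sigma)$ be the equioriented symmetric quiver of type $A_{2n}$: vertices $1,\dots,2n$, arrows $a_i:i\to i+1$ ($1\le i\le 2n-1$), $\sigma(i)=2n+1-i$, $\sigma(a_i)=a_{2n-i}$. Let $\alpha$ be a symmetric dimension vector written $(\alpha_1,\dots,\alpha_n)$ with $\alpha_i=\alpha_{2n+1-i}$, and for $V\in ORep(Q,\alpha)$ write $V(a_i)$ for the maps of the corresponding orthogonal representation (so $V(a_n):V_n\to V_n^*$ is skew-symmetric and $V(a_{2n-i})=-V(a_i)^t$). Then $OSI(Q,\alpha)$ is generated by the following semi-invariants: (i) $\det(V(a_i)\cdots V(a_j))$ for $1\le j\le i\le n-1$ such that $\alpha_j=\alpha_{i+1}<\min\{\alpha_{j+1},\dots,\alpha_i\}$ (vacuous minimum condition when $i=j$); (ii) $\mathrm{pf}(V(a_{2n-i})\cdots V(a_i))$ (Pfaffian of the skew-symmetric map $V_i\to V_i^*$) for $1\le i\le n$ such that $\alpha_i<\min\{\alpha_{i+1},\dots,\alpha_n\}$ (vacuous when $i=n$) and $\alpha_i$ is even.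
   Context: $\mathbb{K}$ is algebraically closed of characteristic 0. Here $Q_0^+=\{1,\dots,n\}$, $Q_1^+=\{a_1,\dots,a_{n-1}\}$, $Q_1^\sigma=\{a_n\}$, $ORep(Q,\alpha)=\bigoplus_{i=1}^{n-1}\mathrm{Hom}(\mathbb{K}^{\alpha_i},\mathbb{K}^{\alpha_{i+1}})\oplus\bigwedge^2(\mathbb{K}^{\alpha_n})^*$, with the action of $SO(Q,\alpha)=\prod_{i=1}^n SL(\alpha_i)$ by $g\cdot V=(g_{ha}V(a)g_{ta}^{-1})$, $g_{\sigma(x)}:=(g_x^{-1})^t$; $OSI(Q,\alpha)=\mathbb{K}[ORep(Q,\alpha)]^{SO(Q,\alpha)}$. $\mathrm{pf}$ denotes the Pfaffian, $\mathrm{pf}(A)^2=\det A$. *)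

theory Defs
  imports "Jordan_Normal_Form.Determinant" "HOL-Computational_Algebra.Polynomial"
    "HOL-Combinatorics.Permutations"
begin

(* Orthogonal representations of the equioriented symmetric quiver of type A_{2n},
   dimension vector alpha given on vertices 1..n (alpha_i = alpha_{2n+1-i}).
   V i (1 <= i < n) is the alpha(i+1) x alpha(i) matrix of V(a_i);
   V n is the skew-symmetric alpha(n) x alpha(n) matrix of V(a_n) : V_n -> V_n^*.
   All other components are the empty matrix (to make the representation unique). *)
definition ORep :: "nat \<Rightarrow> (nat \<Rightarrow> nat) \<Rightarrow> (nat \<Rightarrow> 'a::field mat) set" where
  "ORep n \<alpha> = {V. (\<forall>i\<in>{1..<n}. V i \<in> carrier_mat (\<alpha> (Suc i)) (\<alpha> i))
      \<and> V n \<in> carrier_mat (\<alpha> n) (\<alpha> n) \<and> transpose_mat (V n) = - V n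
      \<and> (\<forall>i. i \<notin> {1..n} \<longrightarrow> V i = 0\<^sub>m 0 0)}"

definition SOgrp :: "nat \<Rightarrow> (nat \<Rightarrow> nat) \<Rightarrow> (nat \<Rightarrow> 'a::field mat) set" where
  "SOgrp n \<alpha> = {g. \<forall>i\<in>{1..n}. g i \<in> carrier_mat (\<alpha> i) (\<alpha> i) \<and> det (g i) = 1}"

definition mat_inv :: "'a::field mat \<Rightarrow> 'a mat" where
  "mat_inv A = (SOME B. inverts_mat A B \<and> inverts_mat B A)"

(* g . V = (g_{ha} V(a) g_{ta}^{-1}), with g_{sigma(n)} = (g_n^{-1})^t *)
definition act :: "nat \<Rightarrow> (nat \<Rightarrow> 'a::field mat) \<Rightarrow> (nat \<Rightarrow> 'a mat) \<Rightarrow> (nat \<Rightarrow> 'a mat)" where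
  "act n g V = (\<lambda>i. if 1 \<le> i \<and> i < n then g (Suc i) * V i * mat_inv (g i)
      else if i = n then transpose_mat (mat_inv (g n)) * V n * mat_inv (g n)
      else V i)"

inductive_set poly_fun :: "nat \<Rightarrow> (nat \<Rightarrow> nat) \<Rightarrow> ((nat \<Rightarrow> 'a::field mat) \<Rightarrow> 'a) set"
  for n :: nat and \<alpha> :: "nat \<Rightarrow> nat" where
  const: "(\<lambda>V. c) \<in> poly_fun n \<alpha>"
| coord1: "1 \<le> i \<Longrightarrow> i < n \<Longrightarrow> r < \<alpha> (Suc i) \<Longrightarrow> s < \<alpha> i \<Longrightarrow>
      (\<lambda>V. V i $$ (r, s)) \<in> poly_fun n \<alpha>"
| coord2: "r < \<alpha> n \<Longrightarrow> s < \<alpha> n \<Longrightarrow> (\<lambda>V. V n $$ (r, s)) \<in> poly_fun n \<alpha>"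
| add: "f \<in> poly_fun n \<alpha> \<Longrightarrow> h \<in> poly_fun n \<alpha> \<Longrightarrow> (\<lambda>V. f V + h V) \<in> poly_fun n \<alpha>"
| mult: "f \<in> poly_fun n \<alpha> \<Longrightarrow> h \<in> poly_fun n \<alpha> \<Longrightarrow> (\<lambda>V. f V * h V) \<in> poly_fun n \<alpha>"

definition OSI :: "nat \<Rightarrow> (nat \<Rightarrow> nat) \<Rightarrow> ((nat \<Rightarrow> 'a::field mat) \<Rightarrow> 'a) set" where
  "OSI n \<alpha> = {f. (\<exists>p\<in>poly_fun n \<alpha>. \<forall>V\<in>ORep n \<alpha>. f V = p V)
      \<and> (\<forall>g\<in>SOgrp n \<alpha>. \<forall>V\<in>ORep n \<alpha>. f (act n g V) = f V)}"

inductive_set alg_gen :: "('b \<Rightarrow> 'a::field) set \<Rightarrow> ('b \<Rightarrow> 'a) set" for S where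
  const: "(\<lambda>V. c) \<in> alg_gen S"
| gen: "f \<in> S \<Longrightarrow> f \<in> alg_gen S"
| add: "f \<in> alg_gen S \<Longrightarrow> h \<in> alg_gen S \<Longrightarrow> (\<lambda>V. f V + h V) \<in> alg_gen S"
| mult: "f \<in> alg_gen S \<Longrightarrow> h \<in> alg_gen S \<Longrightarrow> (\<lambda>V. f V * h V) \<in> alg_gen S"

(* V(a_k) for 1 <= k <= 2n-1, using V(a_{2n-k}) = - V(a_k)^t *)
definition Vfull :: "nat \<Rightarrow> (nat \<Rightarrow> 'a::field mat) \<Rightarrow> nat \<Rightarrow> 'a mat" where
  "Vfull n V k = (if k \<le> n then V k else - transpose_mat (V (2 * n - k)))"

fun mprod :: "(nat \<Rightarrow> 'a::field mat) \<Rightarrow> nat \<Rightarrow> nat \<Rightarrow> 'a mat" where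
  "mprod W j 0 = W j"
| "mprod W j (Suc k) = W (j + Suc k) * mprod W j k"

definition pf :: "'a::field_char_0 mat \<Rightarrow> 'a" where
  "pf A = (let d = dim_row A; m = d div 2 in
     (\<Sum>p | p permutes {..<d}. of_int (sign p) * (\<Prod>k<m. A $$ (p (2 * k), p (2 * k + 1))))
       / (2 ^ m * of_nat (fact m)))"

definition generators :: "nat \<Rightarrow> (nat \<Rightarrow> nat) \<Rightarrow> ((nat \<Rightarrow> 'a::field_char_0 mat) \<Rightarrow> 'a) set" where
  "generators n \<alpha> =
     {f. \<exists>i j. 1 \<le> j \<and> j \<le> i \<and> i \<le> n - 1 \<and> \<alpha> j = \<alpha> (Suc i)
          \<and> (\<forall>k\<in>{j+1..i}. \<alpha> j < \<alpha> k)
          \<and> f = (\<lambda>V. det (mprod (Vfull n V) j (i - j)))}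
   \<union> {f. \<exists>i. 1 \<le> i \<and> i \<le> n \<and> (\<forall>k\<in>{i+1..n}. \<alpha> i < \<alpha> k) \<and> even (\<alpha> i)
          \<and> f = (\<lambda>V. pf (mprod (Vfull n V) i (2 * n - 2 * i)))}"

end

theory Submission
  imports Defs
begin

text \<open>
  The invariants are computed by restriction to a section. Let \<open>srep t\<close> be the representation whose
  arrows are partial identity matrices and whose form is the standard symplectic one, except that the
  arrow leaving vertex \<open>j\<close> carries the parameter \<open>t j\<close> at its last level \<open>\<alpha> j - 1\<close> (for \<open>j = n\<close>: the
  last hyperbolic plane of the form does). If a generator starts at \<open>j\<close>, its value at \<open>srep t\<close> is
  \<open>t j\<close> up to a nonzero constant; at all other vertices the parameter can be normalised to \<open>1\<close> by
  a diagonal element of determinant one. Hence every polynomial function agrees on the section with a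
  polynomial in the generators. The product of the general linear groups has a dense orbit, that of
  \<open>srep 1\<close>, and this orbit is swept out by the section under the special linear groups, so the
  difference of an invariant and that polynomial vanishes identically.

  Density is established without topology: a generic representation is brought to normal form arrow
  by arrow, from left to right, because upper triangular matrices at a vertex extend to
  automorphisms of the normalised arrows before it. The generic position needed in each step is
  reached along lines on which the invariant is a polynomial in one variable.
\<close>

section \<open>Matrices\<close>

text \<open>Call \<open>r\<close> the level of the basis vector \<open>r\<close>. Equal levels at
  consecutive vertices form chains, and most steps are bookkeeping along these chains. The parameter
  of vertex j sits at the last level because the product in a generator starting elsewhere, say at
  j', uses the arrow or form at j only if \<alpha> j' < \<alpha> j; it then never sees level
  \<alpha> j - 1. This is what the strict inequalities in the theorem provide.

  Two facts suffice: an invariant vanishing on the section vanishes everywhere, and every coordinate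
  of the section is a constant or a constant times the value of a generator once the other
  parameters are 1. Relations between generators never enter.

  An invariant is not constant on orbits of the general linear groups, so its value cannot be
  followed through normalisation steps of arbitrary determinant. The property carried through them
  is therefore vanishing on a whole such orbit (\<open>null_orbits\<close>).\<close>

lemma index_mult_mat_sum:
  fixes A B :: "'a::semiring_0 mat"
  assumes "A \<in> carrier_mat l m" "B \<in> carrier_mat m k" "r < l" "s < k"
  shows "(A * B) $$ (r, s) = (\<Sum>i<m. A $$ (r, i) * B $$ (i, s))"
  using assms by (auto simp: scalar_prod_def atLeast0LessThan)

lemma mat_inv_props:
  fixes A :: "'a::field mat"
  assumes A: "A \<in> carrier_mat d d" and "det A \<noteq> 0"
  shows mat_inv_carrier: "mat_inv A \<in> carrier_mat d d"
    and mat_inv_right: "A * mat_inv A = 1\<^sub>m d"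
    and mat_inv_left: "mat_inv A * A = 1\<^sub>m d"
    and det_mat_inv: "det (mat_inv A) = inverse (det A)"
proof -
  obtain B where B: "B \<in> carrier_mat d d" "B * A = 1\<^sub>m d" "A * B = 1\<^sub>m d"
    using det_non_zero_imp_unit[OF assms, of "()"] by (auto simp: Units_def ring_mat_def)
  have "inverts_mat A (mat_inv A) \<and> inverts_mat (mat_inv A) A"
    unfolding mat_inv_def by (rule someI[of _ B]) (use A B in \<open>auto simp: inverts_mat_def\<close>)
  then have 1: "A * mat_inv A = 1\<^sub>m d" "mat_inv A * A = 1\<^sub>m (dim_row (mat_inv A))"
    using A by (auto simp: inverts_mat_def)
  have "dim_col (mat_inv A) = d" using arg_cong[OF 1(1), of dim_col] by simp
  moreover have "dim_row (mat_inv A) = d" using arg_cong[OF 1(2), of dim_col] A by simp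
  ultimately show c: "mat_inv A \<in> carrier_mat d d" by auto
  show "A * mat_inv A = 1\<^sub>m d" by fact
  show "mat_inv A * A = 1\<^sub>m d" using 1(2) c by auto
  have "det A * det (mat_inv A) = 1" using det_mult[OF A c] 1(1) by simp
  then show "det (mat_inv A) = inverse (det A)" by (metis inverse_unique)
qed

section \<open>Algebras of functions\<close>

text \<open>By \<open>cong\<close>, membership depends only on the values on \<open>D\<close>,
  matching \<open>OSI\<close>, which constrains a function only on \<open>ORep\<close>. The
  instances are the polynomial functions on \<open>ORep\<close>, \<open>OSI\<close> itself, and the
  polynomials in one variable that arise along lines.\<close>

locale function_algebra =
  fixes D :: "'b set" and S :: "('b \<Rightarrow> 'a::field_char_0) set"
  assumes const: "(\<lambda>x. c) \<in> S"
    and add: "f \<in> S \<Longrightarrow> h \<in> S \<Longrightarrow> (\<lambda>x. f x + h x) \<in> S"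
    and mult: "f \<in> S \<Longrightarrow> h \<in> S \<Longrightarrow> (\<lambda>x. f x * h x) \<in> S"
    and cong: "f \<in> S \<Longrightarrow> (\<And>x. x \<in> D \<Longrightarrow> f x = h x) \<Longrightarrow> h \<in> S"
begin

lemma sum: "finite I \<Longrightarrow> (\<And>i. i \<in> I \<Longrightarrow> f i \<in> S) \<Longrightarrow> (\<lambda>x. \<Sum>i\<in>I. f i x) \<in> S"
  by (induction rule: finite_induct) (auto intro: const add)

lemma prod: "finite I \<Longrightarrow> (\<And>i. i \<in> I \<Longrightarrow> f i \<in> S) \<Longrightarrow> (\<lambda>x. \<Prod>i\<in>I. f i x) \<in> S"
  by (induction rule: finite_induct) (auto intro: const mult)

lemma uminus: "f \<in> S \<Longrightarrow> (\<lambda>x. - f x) \<in> S"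
  using mult[OF const[of "-1"], of f] by simp

lemma diff: "f \<in> S \<Longrightarrow> h \<in> S \<Longrightarrow> (\<lambda>x. f x - h x) \<in> S"
  using add[OF _ uminus, of f h] by simp

definition Mat :: "nat \<Rightarrow> nat \<Rightarrow> ('b \<Rightarrow> 'a mat) set" where
  "Mat l m = {A. (\<forall>x\<in>D. A x \<in> carrier_mat l m) \<and> (\<forall>r<l. \<forall>s<m. (\<lambda>x. A x $$ (r, s)) \<in> S)}"

lemma Mat_I:
  assumes "\<And>x. x \<in> D \<Longrightarrow> A x \<in> carrier_mat l m"
    and "\<And>r s. r < l \<Longrightarrow> s < m \<Longrightarrow> (\<lambda>x. A x $$ (r, s)) \<in> S"
  shows "A \<in> Mat l m"
  using assms by (auto simp: Mat_def)

lemma Mat_carrier: "A \<in> Mat l m \<Longrightarrow> x \<in> D \<Longrightarrow> A x \<in> carrier_mat l m"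
  and Mat_entry: "A \<in> Mat l m \<Longrightarrow> r < l \<Longrightarrow> s < m \<Longrightarrow> (\<lambda>x. A x $$ (r, s)) \<in> S"
  by (auto simp: Mat_def)

lemma Mat_const: "A \<in> carrier_mat l m \<Longrightarrow> (\<lambda>x. A) \<in> Mat l m"
  by (auto intro: Mat_I const)

lemma Mat_mult:
  assumes A: "A \<in> Mat l m" and B: "B \<in> Mat m k"
  shows "(\<lambda>x. A x * B x) \<in> Mat l k"
proof (rule Mat_I)
  show "A x * B x \<in> carrier_mat l k" if "x \<in> D" for x
    using Mat_carrier[OF A that] Mat_carrier[OF B that] by simp
next
  fix r s assume rs: "r < l" "s < k"
  have "(\<lambda>x. \<Sum>i<m. A x $$ (r, i) * B x $$ (i, s)) \<in> S"
    by (intro sum mult Mat_entry[OF A] Mat_entry[OF B] rs) auto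
  then show "(\<lambda>x. (A x * B x) $$ (r, s)) \<in> S"
    by (rule cong) (rule index_mult_mat_sum[OF Mat_carrier[OF A] Mat_carrier[OF B] rs, symmetric])
qed

lemma Mat_transpose:
  assumes A: "A \<in> Mat l m"
  shows "(\<lambda>x. transpose_mat (A x)) \<in> Mat m l"
proof (rule Mat_I)
  show "transpose_mat (A x) \<in> carrier_mat m l" if "x \<in> D" for x
    using Mat_carrier[OF A that] by simp
  show "(\<lambda>x. transpose_mat (A x) $$ (r, s)) \<in> S" if "r < m" "s < l" for r s
    by (rule cong[OF Mat_entry[OF A that(2,1)]]) (use that in \<open>auto dest!: Mat_carrier[OF A]\<close>)
qed

lemma Mat_uminus:
  assumes A: "A \<in> Mat l m"
  shows "(\<lambda>x. - A x) \<in> Mat l m"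
proof (rule Mat_I)
  show "- A x \<in> carrier_mat l m" if "x \<in> D" for x
    using Mat_carrier[OF A that] by simp
  show "(\<lambda>x. (- A x) $$ (r, s)) \<in> S" if "r < l" "s < m" for r s
    by (rule cong[OF uminus[OF Mat_entry[OF A that]]]) (use that in \<open>auto dest!: Mat_carrier[OF A]\<close>)
qed

lemma det:
  assumes A: "A \<in> Mat m m"
  shows "(\<lambda>x. det (A x)) \<in> S"
proof -
  have "(\<lambda>x. \<Sum>p\<in>{p. p permutes {0..<m}}. signof p * (\<Prod>i\<in>{0..<m}. A x $$ (i, p i))) \<in> S"
    by (intro sum mult prod const Mat_entry[OF A] finite_permutations)
      (auto simp: permutes_in_image[of _ "{0..<m}", simplified])
  then show ?thesis
    by (rule cong) (rule det_def'[OF Mat_carrier[OF A], symmetric])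
qed

lemma pf:
  assumes A: "A \<in> Mat m m"
  shows "(\<lambda>x. pf (A x)) \<in> S"
proof -
  have "(\<lambda>x. (\<Sum>p\<in>{p. p permutes {..<m}}.
      of_int (sign p) * (\<Prod>k<m div 2. A x $$ (p (2 * k), p (2 * k + 1))))
       * inverse (2 ^ (m div 2) * of_nat (fact (m div 2)))) \<in> S"
    by (intro sum mult prod const Mat_entry[OF A] finite_permutations)
      (auto simp: permutes_in_image[of _ "{..<m}", unfolded lessThan_iff])
  then show ?thesis
    by (rule cong) (use Mat_carrier[OF A] in \<open>auto simp: pf_def Let_def divide_inverse\<close>)
qed

end

section \<open>Pfaffians\<close>

lemma prod_pairs:
  fixes g :: "nat \<Rightarrow> 'a::comm_monoid_mult"
  shows "(\<Prod>k<m. g (2 * k) * g (2 * k + 1)) = (\<Prod>i<2 * m. g i)"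
  by (induction m) (auto simp: mult.assoc)

lemma pf_congruence:
  fixes A B :: "'a::field_char_0 mat"
  assumes A: "A \<in> carrier_mat (2 * m) (2 * m)" and B: "B \<in> carrier_mat (2 * m) (2 * m)"
  shows "pf (transpose_mat B * A * B) = det B * pf A"
proof -
  define d where "d = 2 * m"
  define \<Phi> where "\<Phi> = PiE {..<m} (\<lambda>_. {..<d} \<times> {..<d})"
  define q where "q \<phi> i = (if even i then fst (\<phi> (i div 2)) else snd (\<phi> (i div 2)))"
    for \<phi> :: "nat \<Rightarrow> nat \<times> nat" and i
  define Q :: "(nat \<Rightarrow> nat \<times> nat) \<Rightarrow> 'a mat"
    where "Q \<phi> = mat d d (\<lambda>(i, a). if a = q \<phi> i then 1 else 0)" for \<phi>
  define T where "T B = (\<Sum>p | p permutes {..<d}. of_int (sign p) *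
      (\<Prod>k<m. (transpose_mat B * A * B) $$ (p (2 * k), p (2 * k + 1))))" for B :: "'a mat"
  \<comment> \<open>Multilinear expansion; the factor \<open>det B\<close> splits off since the rows of \<open>B\<close> picked out by
    \<open>\<phi>\<close> form the product \<open>Q \<phi> * B\<close>. Comparing with \<open>B = 1\<close> identifies the remaining sum.\<close>
  have expand: "T B = det B * (\<Sum>\<phi>\<in>\<Phi>. (\<Prod>k<m. A $$ \<phi> k) * det (Q \<phi>))"
    if B: "B \<in> carrier_mat d d" for B
  proof -
    have A': "A \<in> carrier_mat d d" using A by (simp add: d_def)
    have entry: "(transpose_mat B * A * B) $$ (r, s)
        = (\<Sum>x\<in>{..<d} \<times> {..<d}. A $$ x * (B $$ (fst x, r) * B $$ (snd x, s)))"
      if "r < d" "s < d" for r s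
    proof -
      have "(transpose_mat B * A * B) $$ (r, s)
          = (\<Sum>j<d. (\<Sum>i<d. transpose_mat B $$ (r, i) * A $$ (i, j)) * B $$ (j, s))"
        using that A' B by (subst index_mult_mat_sum[of _ d d]) (auto simp: index_mult_mat_sum[of _ d d _ d] simp del: index_mult_mat)
      also have "\<dots> = (\<Sum>j<d. \<Sum>i<d. A $$ (i, j) * (B $$ (i, r) * B $$ (j, s)))"
        using that A' B by (intro sum.cong) (auto simp: sum_distrib_left sum_distrib_right mult_ac)
      also have "\<dots> = (\<Sum>x\<in>{..<d} \<times> {..<d}. A $$ x * (B $$ (fst x, r) * B $$ (snd x, s)))"
        by (subst sum.swap) (simp add: sum.cartesian_product case_prod_beta)
      finally show ?thesis .
    qed
    have "T B = (\<Sum>p | p permutes {..<d}. of_int (sign p) * (\<Prod>k<m.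
        \<Sum>x\<in>{..<d} \<times> {..<d}. A $$ x * (B $$ (fst x, p (2 * k)) * B $$ (snd x, p (2 * k + 1)))))"
      unfolding T_def
    proof (intro sum.cong refl arg_cong2[of _ _ _ _ "(*)"] prod.cong entry)
      fix p k assume "p \<in> {p. p permutes {..<d}}" "k \<in> {..<m}"
      then show "p (2 * k) < d" "p (2 * k + 1) < d"
        using permutes_in_image[of p "{..<d}"] by (auto simp: d_def)
    qed
    also have "\<dots> = (\<Sum>p | p permutes {..<d}. \<Sum>\<phi>\<in>\<Phi>. of_int (sign p) * (\<Prod>k<m.
        A $$ \<phi> k * (B $$ (fst (\<phi> k), p (2 * k)) * B $$ (snd (\<phi> k), p (2 * k + 1)))))"
      unfolding \<Phi>_def by (subst prod_sum_PiE) (auto simp: sum_distrib_left)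
    also have "\<dots> = (\<Sum>\<phi>\<in>\<Phi>. (\<Prod>k<m. A $$ \<phi> k) *
        (\<Sum>p | p permutes {..<d}. of_int (sign p) * (\<Prod>i<d. B $$ (q \<phi> i, p i))))"
    proof (subst sum.swap, intro sum.cong refl)
      fix \<phi>
      have "(\<Prod>k<m. B $$ (fst (\<phi> k), p (2 * k)) * B $$ (snd (\<phi> k), p (2 * k + 1)))
          = (\<Prod>i<d. B $$ (q \<phi> i, p i))" for p
        using prod_pairs[of "\<lambda>i. B $$ (q \<phi> i, p i)" m] by (simp add: q_def d_def)
      then show "(\<Sum>p | p permutes {..<d}. of_int (sign p) * (\<Prod>k<m.
          A $$ \<phi> k * (B $$ (fst (\<phi> k), p (2 * k)) * B $$ (snd (\<phi> k), p (2 * k + 1)))))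
        = (\<Prod>k<m. A $$ \<phi> k) *
          (\<Sum>p | p permutes {..<d}. of_int (sign p) * (\<Prod>i<d. B $$ (q \<phi> i, p i)))"
        by (simp add: prod.distrib sum_distrib_left mult_ac)
    qed
    also have "\<dots> = (\<Sum>\<phi>\<in>\<Phi>. (\<Prod>k<m. A $$ \<phi> k) * det (Q \<phi> * B))"
    proof (intro sum.cong refl arg_cong2[of _ _ _ _ "(*)"])
      fix \<phi> assume \<phi>: "\<phi> \<in> \<Phi>"
      have q: "q \<phi> i < d" if "i < d" for i
      proof -
        have "\<phi> (i div 2) \<in> {..<d} \<times> {..<d}"
          by (rule PiE_mem[OF \<phi>[unfolded \<Phi>_def]]) (use that in \<open>auto simp: d_def\<close>)
        then show ?thesis by (auto simp: q_def mem_Times_iff)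
      qed
      have Qc: "Q \<phi> \<in> carrier_mat d d" by (simp add: Q_def)
      have QB: "(Q \<phi> * B) $$ (i, j) = B $$ (q \<phi> i, j)" if "i < d" "j < d" for i j
      proof -
        have "(Q \<phi> * B) $$ (i, j) = (\<Sum>a<d. if a = q \<phi> i then B $$ (a, j) else 0)"
          unfolding index_mult_mat_sum[OF Qc B that] using that
          by (intro sum.cong) (auto simp: Q_def)
        then show ?thesis using q[OF that(1)] by (simp add: sum.delta)
      qed
      have "det (Q \<phi> * B) = (\<Sum>p | p permutes {..<d}. signof p * (\<Prod>i<d. (Q \<phi> * B) $$ (i, p i)))"
        by (subst det_def'[of _ d]) (use Qc B in \<open>auto simp: atLeast0LessThan\<close>)
      also have "\<dots> = (\<Sum>p | p permutes {..<d}. of_int (sign p) * (\<Prod>i<d. B $$ (q \<phi> i, p i)))"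
      proof (intro sum.cong refl arg_cong2[of _ _ _ _ "(*)"] prod.cong QB)
        fix p i assume "p \<in> {p. p permutes {..<d}}" "i \<in> {..<d}"
        then show "i < d" "p i < d" using permutes_in_image[of p "{..<d}"] by auto
      qed 
      finally show "(\<Sum>p | p permutes {..<d}. of_int (sign p) * (\<Prod>i<d. B $$ (q \<phi> i, p i)))
        = det (Q \<phi> * B)" by simp
    qed
    also have "\<dots> = det B * (\<Sum>\<phi>\<in>\<Phi>. (\<Prod>k<m. A $$ \<phi> k) * det (Q \<phi>))"
    proof -
      have "Q \<phi> \<in> carrier_mat d d" for \<phi> by (simp add: Q_def)
      then show ?thesis by (simp add: det_mult[OF _ B] sum_distrib_left mult_ac)
    qed
    finally show ?thesis .
  qed
  have "T B = det B * T (1\<^sub>m d)"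
    using expand[of B] expand[of "1\<^sub>m d"] B by (simp add: d_def)
  moreover have "pf (transpose_mat B * A * B) = T B / (2 ^ m * of_nat (fact m))"
    using A B by (simp add: pf_def T_def d_def)
  moreover have "pf A = T (1\<^sub>m d) / (2 ^ m * of_nat (fact m))"
    using A by (simp add: pf_def T_def d_def)
  ultimately show ?thesis by simp
qed

text \<open>Entries of the block diagonal matrix with blocks (0, 1; -1, 0), on all pairs of indices
  so that one function serves every size. Cut at an odd size, its last row and column
  vanish.\<close>

definition jform :: "nat \<Rightarrow> nat \<Rightarrow> 'a::comm_ring_1" where
  "jform r s = (if even r \<and> s = Suc r then 1 else if even s \<and> r = Suc s then -1 else 0)"

lemma jform_skew: "jform r s = - jform s r"
  by (auto simp: jform_def)

lemma jform_nonzero_iff: "jform r s \<noteq> (0::'a::field_char_0) \<longleftrightarrow> even r \<and> s = Suc r \<or> even s \<and> r = Suc s"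
  by (auto simp: jform_def)

text \<open>Moving the pairs {2i, 2i+1} as rigid blocks is even: exchanging two blocks takes two
  transpositions of points.\<close>

lemma sign_double:
  assumes "\<pi> permutes {..<m}"
  shows "(\<lambda>i. 2 * \<pi> (i div 2) + i mod 2) permutes {..<2 * m}
    \<and> sign (\<lambda>i::nat. 2 * \<pi> (i div 2) + i mod 2) = 1"
  using assms finite_lessThan
proof (induction rule: permutes_induct)
  case id
  have "(\<lambda>i::nat. 2 * id (i div 2) + i mod 2) = id" by auto
  then show ?case by (simp add: permutes_id)
next
  case (swap a b \<pi>)
  define f where "f = (\<lambda>i::nat. 2 * \<pi> (i div 2) + i mod 2)"
  define t where "t = Transposition.transpose (2 * a) (2 * b) \<circ> Transposition.transpose (2 * a + 1) (2 * b + 1)"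
  have f: "f permutes {..<2 * m}" "sign f = 1" using swap by (auto simp: f_def)
  have eq: "(\<lambda>i. 2 * (Transposition.transpose a b \<circ> \<pi>) (i div 2) + i mod 2) = t \<circ> f"
  proof
    fix i :: nat
    have "i mod 2 = 0 \<or> i mod 2 = 1" by auto
    then show "2 * (Transposition.transpose a b \<circ> \<pi>) (i div 2) + i mod 2 = (t \<circ> f) i"
      by (auto simp: t_def f_def Transposition.transpose_def)
  qed
  have t: "t permutes {..<2 * m}"
    unfolding t_def using swap by (intro permutes_compose permutes_swap_id) auto
  have "sign t = 1"
    unfolding t_def by (subst sign_compose) (auto simp: permutation_swap_id sign_swap_id)
  then have "sign (t \<circ> f) = 1"
    using t f by (subst sign_compose) (auto intro: permutation_permutes[THEN iffD2])
  then show ?case using permutes_compose[OF f(1) t] by (simp only: eq)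
qed

text \<open>Nonzero factors force \<open>p\<close> to map pairs onto pairs. Reversing one pair flips
  both the sign of \<open>p\<close> and one factor, so induction on the number of reversed pairs
  leads to the block permutations of \<open>sign_double\<close>. Hence the terms of this Pfaffian
  cannot cancel.\<close>

lemma sign_eq_prod_jform:
  fixes p :: "nat \<Rightarrow> nat"
  assumes "p permutes {..<2 * m}"
    and "\<And>k. k < m \<Longrightarrow> jform (p (2 * k)) (p (2 * k + 1)) \<noteq> (0::'a::field_char_0)"
  shows "of_int (sign p) * (\<Prod>k<m. jform (p (2 * k)) (p (2 * k + 1))) = (1::'a)"
  using assms
proof (induction "card {k. k < m \<and> odd (p (2 * k))}" arbitrary: p)
  case 0
  have even: "even (p (2 * k))" if "k < m" for k using 0(1) that by auto
  have Suc: "p (2 * k + 1) = Suc (p (2 * k))" if "k < m" for k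
    using 0(3)[OF that] even[OF that] by (auto simp: jform_nonzero_iff)
  define \<pi> where "\<pi> k = (if k < m then p (2 * k) div 2 else k)" for k
  have p\<pi>: "p = (\<lambda>i. 2 * \<pi> (i div 2) + i mod 2)"
  proof
    fix i
    show "p i = 2 * \<pi> (i div 2) + i mod 2"
    proof (cases "i < 2 * m")
      case True
      then have lt: "i div 2 < m" by auto
      have "p (2 * (i div 2) + i mod 2) = 2 * \<pi> (i div 2) + i mod 2"
        using even[OF lt] Suc[OF lt] lt by (cases "even i") (auto simp: \<pi>_def odd_iff_mod_2_eq_one)
      then show ?thesis by simp
    next
      case False
      then have "p i = i" using 0(2) by (auto simp: permutes_def)
      then show ?thesis using False by (auto simp: \<pi>_def)
    qed
  qed
  have "\<pi> permutes {..<m}"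
  proof (rule bij_imp_permutes)
    have "\<pi> k < m" if "k < m" for k
      using permutes_in_image[OF 0(2), of "2 * k"] that by (auto simp: \<pi>_def)
    moreover have "inj_on \<pi> {..<m}"
    proof (rule inj_onI)
      fix a b assume ab: "a \<in> {..<m}" "b \<in> {..<m}" "\<pi> a = \<pi> b"
      then have "p (2 * a) = p (2 * b)" unfolding p\<pi> by simp
      then have "2 * a = 2 * b" by (rule injD[OF permutes_inj[OF 0(2)]])
      then show "a = b" by simp
    qed
    ultimately show "bij_betw \<pi> {..<m} {..<m}"
      unfolding bij_betw_def by (intro conjI endo_inj_surj) auto
  qed (auto simp: \<pi>_def)
  then have "sign p = 1" using sign_double[of \<pi> m] p\<pi> by simp
  moreover have "jform (p (2 * k)) (p (2 * k + 1)) = (1::'a)" if "k < m" for k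
    using Suc[OF that] even[OF that] by (simp add: jform_def)
  ultimately show ?case by simp
next
  case (Suc c)
  then have "{k. k < m \<and> odd (p (2 * k))} \<noteq> {}" by (metis card.empty nat.distinct(1))
  then obtain l where l: "l < m" "odd (p (2 * l))" by auto
  \<comment> \<open>Exchanging the arguments 2l and 2l + 1 undoes the reversal of pair l and touches
    no other pair.\<close>
  define p' where "p' = p \<circ> Transposition.transpose (2 * l) (2 * l + 1)"
  have p': "p' permutes {..<2 * m}"
    unfolding p'_def using l Suc.prems by (intro permutes_compose permutes_swap_id) auto
  have p'l: "p' (2 * l) = p (2 * l + 1)" "p' (2 * l + 1) = p (2 * l)"
    by (auto simp: p'_def)
  have p'k: "p' (2 * k) = p (2 * k)" "p' (2 * k + 1) = p (2 * k + 1)" if "k \<noteq> l" for k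
  proof -
    have "2 * k \<noteq> 2 * l" "2 * k \<noteq> 2 * l + 1" "2 * k + 1 \<noteq> 2 * l" "2 * k + 1 \<noteq> 2 * l + 1"
      using that by presburger+
    then show "p' (2 * k) = p (2 * k)" "p' (2 * k + 1) = p (2 * k + 1)"
      by (auto simp: p'_def Transposition.transpose_def)
  qed
  have "even (p (2 * l + 1))"
    using Suc.prems(2)[OF l(1)] l(2) by (auto simp: jform_nonzero_iff)
  then have "{k. k < m \<and> odd (p' (2 * k))} = {k. k < m \<and> odd (p (2 * k))} - {l}"
    using p'l p'k by (auto split: if_splits) metis+
  then have c: "c = card {k. k < m \<and> odd (p' (2 * k))}"
    using Suc.hyps(2) l by simp
  have nz: "jform (p' (2 * k)) (p' (2 * k + 1)) \<noteq> (0::'a)" if "k < m" for k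
    using Suc.prems(2)[OF that] p'l p'k[of k] jform_skew[of "p (2 * l)" "p (2 * l + 1)", where ?'a = 'a]
    by (cases "k = l") auto
  have IH: "of_int (sign p') * (\<Prod>k<m. jform (p' (2 * k)) (p' (2 * k + 1))) = (1::'a)"
    by (rule Suc.hyps(1)[OF c p' nz])
  have "sign p' = - sign p"
    unfolding p'_def using Suc.prems(1)
    by (subst sign_compose) (auto simp: permutation_swap_id sign_swap_id intro: permutation_permutes[THEN iffD2])
  moreover have "(\<Prod>k<m. jform (p' (2 * k)) (p' (2 * k + 1)))
      = - (\<Prod>k<m. jform (p (2 * k)) (p (2 * k + 1)) :: 'a)"
  proof -
    have "(\<Prod>k<m. jform (p' (2 * k)) (p' (2 * k + 1)))
        = jform (p' (2 * l)) (p' (2 * l + 1)) * (\<Prod>k\<in>{..<m} - {l}. jform (p' (2 * k)) (p' (2 * k + 1)) :: 'a)"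
      using l by (subst prod.remove[of _ l]) auto
    also have "\<dots> = - (jform (p (2 * l)) (p (2 * l + 1)) * (\<Prod>k\<in>{..<m} - {l}. jform (p (2 * k)) (p (2 * k + 1))))"
      using p'l p'k jform_skew[of "p (2 * l + 1)" "p (2 * l)", where ?'a = 'a] by simp
    also have "\<dots> = - (\<Prod>k<m. jform (p (2 * k)) (p (2 * k + 1)) :: 'a)"
      using l by (subst (2) prod.remove[of _ l]) auto
    finally show ?thesis .
  qed
  ultimately show ?case using IH by simp
qed

text \<open>Each index occurs exactly once in every Pfaffian term, so scaling rows and columns by
  \<open>x\<close> contributes the product of the \<open>x i\<close> once, not squared;
  \<open>c\<close> enters once per pair.\<close>

lemma pf_jform_scaled:
  fixes x :: "nat \<Rightarrow> 'a::field_char_0"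
  shows "pf (mat (2 * m) (2 * m) (\<lambda>(r, s). c * jform r s * x r * x s))
    = c ^ m * (\<Prod>i<2 * m. x i) * pf (mat (2 * m) (2 * m) (\<lambda>(r, s). jform r s))"
proof -
  have "(\<Prod>k<m. mat (2 * m) (2 * m) (\<lambda>(r, s). c * jform r s * x r * x s) $$ (p (2 * k), p (2 * k + 1)))
      = c ^ m * (\<Prod>i<2 * m. x i) *
        (\<Prod>k<m. mat (2 * m) (2 * m) (\<lambda>(r, s). jform r s) $$ (p (2 * k), p (2 * k + 1)))"
    if p: "p permutes {..<2 * m}" for p
  proof -
    have lt: "p (2 * k) < 2 * m" "p (2 * k + 1) < 2 * m" if "k < m" for k
      using permutes_in_image[OF p] that by auto
    have "(\<Prod>k<m. mat (2 * m) (2 * m) (\<lambda>(r, s). c * jform r s * x r * x s) $$ (p (2 * k), p (2 * k + 1)))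
      = (\<Prod>k<m. c * (x (p (2 * k)) * x (p (2 * k + 1))) *
          mat (2 * m) (2 * m) (\<lambda>(r, s). jform r s) $$ (p (2 * k), p (2 * k + 1)))"
      using lt by (intro prod.cong) (auto simp: mult_ac)
    also have "\<dots> = c ^ m * (\<Prod>i<2 * m. x (p i)) *
        (\<Prod>k<m. mat (2 * m) (2 * m) (\<lambda>(r, s). jform r s) $$ (p (2 * k), p (2 * k + 1)))"
      using prod_pairs[of "\<lambda>i. x (p i)" m] by (simp add: prod.distrib)
    also have "(\<Prod>i<2 * m. x (p i)) = (\<Prod>i<2 * m. x i)"
      using prod.permute[OF p, of x] by (simp add: o_def)
    finally show ?thesis .
  qed
  then show ?thesis
    by (simp add: pf_def Let_def sum_distrib_left mult_ac)
qed

text \<open>All nonzero terms equal 1 and the identity gives one of them, so the sum is a positive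
  integer, nonzero in characteristic 0.\<close>

lemma pf_jform_nonzero:
  "pf (mat (2 * m) (2 * m) (\<lambda>(r, s). jform r s)) \<noteq> (0::'a::field_char_0)"
proof -
  define T where "T p = of_int (sign p) *
    (\<Prod>k<m. mat (2 * m) (2 * m) (\<lambda>(r, s). jform r s) $$ (p (2 * k), p (2 * k + 1)) :: 'a)" for p
  define P where "P = {p. p permutes {..<2 * m}}"
  define R where "R = {p\<in>P. T p \<noteq> 0}"
  have fin: "finite P" by (simp add: P_def finite_permutations)
  have 1: "T p = 1" if "p \<in> R" for p
  proof -
    have p: "p permutes {..<2 * m}" "T p \<noteq> 0" using that by (auto simp: R_def P_def)
    have lt: "p (2 * k) < 2 * m" "p (2 * k + 1) < 2 * m" if "k < m" for k
      using permutes_in_image[OF p(1)] that by auto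
    then have T: "T p = of_int (sign p) * (\<Prod>k<m. jform (p (2 * k)) (p (2 * k + 1)))"
      unfolding T_def by (intro arg_cong2[of _ _ _ _ "(*)"] prod.cong) auto
    then have "jform (p (2 * k)) (p (2 * k + 1)) \<noteq> (0::'a)" if "k < m" for k
      using p(2) that by auto
    then show ?thesis unfolding T by (rule sign_eq_prod_jform[OF p(1)])
  qed
  have "(\<Sum>p\<in>P. T p) = (\<Sum>p\<in>R. T p)"
    by (rule sum.mono_neutral_right) (auto simp: R_def fin)
  also have "\<dots> = of_nat (card R)" using 1 by simp
  also have "\<dots> \<noteq> 0"
  proof -
    have "T id = 1" by (auto simp: T_def jform_def intro!: prod.neutral)
    then have "id \<in> R" by (simp add: R_def P_def permutes_id)
    then show ?thesis using fin by (auto simp: R_def)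
  qed
  finally show ?thesis by (simp add: pf_def Let_def T_def P_def)
qed

section \<open>The group action\<close>

definition GLgrp :: "nat \<Rightarrow> (nat \<Rightarrow> nat) \<Rightarrow> (nat \<Rightarrow> 'a::field mat) set" where
  "GLgrp n \<alpha> = {g. \<forall>i\<in>{1..n}. g i \<in> carrier_mat (\<alpha> i) (\<alpha> i) \<and> det (g i) \<noteq> 0}"

lemma SOgrp_subset_GLgrp: "SOgrp n \<alpha> \<subseteq> GLgrp n \<alpha>"
  by (auto simp: SOgrp_def GLgrp_def)

lemma GLgrp_D:
  assumes "g \<in> GLgrp n \<alpha>" "1 \<le> i" "i \<le> n"
  shows "g i \<in> carrier_mat (\<alpha> i) (\<alpha> i)" "det (g i) \<noteq> 0"
  using assms by (auto simp: GLgrp_def)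

lemma ORep_D:
  assumes "V \<in> ORep n \<alpha>"
  shows "1 \<le> i \<Longrightarrow> i < n \<Longrightarrow> V i \<in> carrier_mat (\<alpha> (Suc i)) (\<alpha> i)"
    and "V n \<in> carrier_mat (\<alpha> n) (\<alpha> n)"
    and "i \<notin> {1..n} \<Longrightarrow> V i = 0\<^sub>m 0 0"
    and "r < \<alpha> n \<Longrightarrow> s < \<alpha> n \<Longrightarrow> V n $$ (r, s) = - V n $$ (s, r)"
proof -
  show V: "V n \<in> carrier_mat (\<alpha> n) (\<alpha> n)" using assms by (simp add: ORep_def)
  show "V n $$ (r, s) = - V n $$ (s, r)" if "r < \<alpha> n" "s < \<alpha> n"
  proof -
    have "transpose_mat (V n) $$ (s, r) = (- V n) $$ (s, r)"
      using assms by (simp add: ORep_def)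
    then show ?thesis using that V by simp
  qed
qed (use assms in \<open>auto simp: ORep_def\<close>)

lemma ORep_I:
  assumes "\<And>i. 1 \<le> i \<Longrightarrow> i < n \<Longrightarrow> V i \<in> carrier_mat (\<alpha> (Suc i)) (\<alpha> i)"
    and "V n \<in> carrier_mat (\<alpha> n) (\<alpha> n)"
    and "\<And>r s. r < \<alpha> n \<Longrightarrow> s < \<alpha> n \<Longrightarrow> V n $$ (r, s) = - V n $$ (s, r)"
    and "\<And>i. i \<notin> {1..n} \<Longrightarrow> V i = 0\<^sub>m 0 0"
  shows "V \<in> ORep n \<alpha>"
proof -
  have "transpose_mat (V n) = - V n"
  proof (rule eq_matI)
    fix r s assume "r < dim_row (- V n)" "s < dim_col (- V n)"
    then have "r < \<alpha> n" "s < \<alpha> n" using assms(2) by auto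
    then show "transpose_mat (V n) $$ (r, s) = (- V n) $$ (r, s)"
      using assms(2) assms(3)[of s r] by simp
  qed (use assms(2) in auto)
  then show ?thesis using assms(1,2,4) by (auto simp: ORep_def)
qed

lemma act_ORep:
  fixes g V :: "nat \<Rightarrow> 'a::field mat"
  assumes n: "n \<ge> 1" and g: "g \<in> GLgrp n \<alpha>" and V: "V \<in> ORep n \<alpha>"
  shows "act n g V \<in> ORep n \<alpha>"
proof -
  have inv: "mat_inv (g i) \<in> carrier_mat (\<alpha> i) (\<alpha> i)" if "1 \<le> i" "i \<le> n" for i
    by (rule mat_inv_carrier[OF GLgrp_D[OF g that]])
  have "act n g V i \<in> carrier_mat (\<alpha> (Suc i)) (\<alpha> i)" if "1 \<le> i" "i < n" for i
    using that inv[of i] GLgrp_D(1)[OF g, of "Suc i"] ORep_D(1)[OF V that] by (auto simp: act_def)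
  moreover have "act n g V n \<in> carrier_mat (\<alpha> n) (\<alpha> n)"
    using n inv[of n] ORep_D(2)[OF V] by (auto simp: act_def)
  moreover have "transpose_mat (act n g V n) = - act n g V n"
  proof -
    have h: "mat_inv (g n) \<in> carrier_mat (\<alpha> n) (\<alpha> n)" using n inv by auto
    note Vn = ORep_D(2)[OF V]
    have "transpose_mat (transpose_mat (mat_inv (g n)) * V n * mat_inv (g n))
        = transpose_mat (mat_inv (g n)) * (- V n * mat_inv (g n))"
      using h Vn V by (simp add: transpose_mult[of _ "\<alpha> n" "\<alpha> n" _ "\<alpha> n"] ORep_def)
    also have "\<dots> = - (transpose_mat (mat_inv (g n)) * (V n * mat_inv (g n)))"
      using h Vn by simp
    also have "\<dots> = - (transpose_mat (mat_inv (g n)) * V n * mat_inv (g n))"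
      using h Vn by (subst assoc_mult_mat[of _ "\<alpha> n" "\<alpha> n" _ "\<alpha> n" _ "\<alpha> n"]) auto
    finally show ?thesis using n by (simp add: act_def)
  qed
  moreover have "act n g V i = 0\<^sub>m 0 0" if "i \<notin> {1..n}" for i
    using that ORep_D(3)[OF V that] n by (auto simp: act_def)
  ultimately show ?thesis by (auto simp: ORep_def)
qed

lemma act_D:
  fixes g V :: "nat \<Rightarrow> 'a::field mat"
  assumes n: "n \<ge> 1" and g: "g \<in> GLgrp n \<alpha>" and V: "V \<in> ORep n \<alpha>"
  shows "1 \<le> i \<Longrightarrow> i < n \<Longrightarrow> g (Suc i) * V i = act n g V i * g i"
    and "V n = transpose_mat (g n) * act n g V n * g n"
proof -
  show "g (Suc i) * V i = act n g V i * g i" if i: "1 \<le> i" "i < n"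
  proof -
    have gi: "g i \<in> carrier_mat (\<alpha> i) (\<alpha> i)" "det (g i) \<noteq> 0" using GLgrp_D[OF g, of i] i by auto
    have gV: "g (Suc i) * V i \<in> carrier_mat (\<alpha> (Suc i)) (\<alpha> i)"
      using GLgrp_D(1)[OF g, of "Suc i"] ORep_D(1)[OF V i] i by auto
    have "act n g V i * g i = g (Suc i) * V i * mat_inv (g i) * g i" using i by (simp add: act_def)
    also have "\<dots> = g (Suc i) * V i * (mat_inv (g i) * g i)"
      by (rule assoc_mult_mat[OF gV mat_inv_carrier[OF gi] gi(1)])
    also have "\<dots> = g (Suc i) * V i"
      by (simp only: mat_inv_left[OF gi] right_mult_one_mat[OF gV])
    finally show ?thesis by simp
  qed
  note gn = GLgrp_D[OF g n le_refl] and Vn = ORep_D(2)[OF V]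
  note h = mat_inv_carrier[OF gn]
  have t: "transpose_mat (g n) * transpose_mat (mat_inv (g n)) = 1\<^sub>m (\<alpha> n)"
    using gn h mat_inv_left[OF gn] by (metis transpose_mult transpose_one)
  have "transpose_mat (g n) * act n g V n * g n
      = (transpose_mat (g n) * transpose_mat (mat_inv (g n))) * (V n * (mat_inv (g n) * g n))"
    using gn h Vn by (simp add: act_def assoc_mult_mat[of _ "\<alpha> n" "\<alpha> n" _ "\<alpha> n" _ "\<alpha> n"])
  then show "V n = transpose_mat (g n) * act n g V n * g n"
    using Vn t mat_inv_left[OF gn] by simp
qed

text \<open>Group elements are constructed later so that these inverse-free intertwining equations
  can be checked entrywise.\<close>

lemma act_eqI:
  fixes g V W :: "nat \<Rightarrow> 'a::field mat"
  assumes n: "n \<ge> 1" and g: "g \<in> GLgrp n \<alpha>" and V: "V \<in> ORep n \<alpha>" and W: "W \<in> ORep n \<alpha>"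
    and arrow: "\<And>i. 1 \<le> i \<Longrightarrow> i < n \<Longrightarrow> g (Suc i) * V i = W i * g i"
    and form: "V n = transpose_mat (g n) * W n * g n"
  shows "act n g V = W"
proof
  fix i
  consider "1 \<le> i" "i < n" | "i = n" | "i \<notin> {1..n}" by fastforce
  then show "act n g V i = W i"
  proof cases
    case 1
    note gi = GLgrp_D[OF g 1(1)] and Wi = ORep_D(1)[OF W 1]
    have gi': "g i \<in> carrier_mat (\<alpha> i) (\<alpha> i)" "det (g i) \<noteq> 0" using gi 1 by auto
    have "act n g V i = W i * g i * mat_inv (g i)" using 1 arrow by (simp add: act_def)
    also have "\<dots> = W i * (g i * mat_inv (g i))"
      by (rule assoc_mult_mat[OF Wi gi'(1) mat_inv_carrier[OF gi']])
    also have "\<dots> = W i" using Wi mat_inv_right[OF gi'] by simp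
    finally show ?thesis .
  next
    case 2
    note gn = GLgrp_D[OF g n le_refl] and Wn = ORep_D(2)[OF W]
    note h = mat_inv_carrier[OF gn]
    have t: "transpose_mat (mat_inv (g n)) * transpose_mat (g n) = 1\<^sub>m (\<alpha> n)"
      using gn h mat_inv_right[OF gn] by (metis transpose_mult transpose_one)
    have "act n g V n
        = (transpose_mat (mat_inv (g n)) * transpose_mat (g n)) * (W n * (g n * mat_inv (g n)))"
      using gn h Wn form n by (simp add: act_def assoc_mult_mat[of _ "\<alpha> n" "\<alpha> n" _ "\<alpha> n" _ "\<alpha> n"])
    then show ?thesis using 2 Wn t mat_inv_right[OF gn] by simp
  next
    case 3
    then show ?thesis using n ORep_D(3)[OF V 3] ORep_D(3)[OF W 3] by (auto simp: act_def)
  qed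
qed

lemma GLgrp_mult:
  assumes "g \<in> GLgrp n \<alpha>" "h \<in> GLgrp n \<alpha>"
  shows "(\<lambda>i. g i * h i) \<in> GLgrp n \<alpha>"
  unfolding GLgrp_def
proof (intro CollectI ballI conjI)
  fix i assume "i \<in> {1..n}"
  then have i: "1 \<le> i" "i \<le> n" by auto
  note gi = GLgrp_D[OF assms(1) i] and hi = GLgrp_D[OF assms(2) i]
  show "g i * h i \<in> carrier_mat (\<alpha> i) (\<alpha> i)" "det (g i * h i) \<noteq> 0"
    using gi hi by (simp_all add: det_mult[OF gi(1) hi(1)])
qed

lemma GLgrp_inverse:
  assumes "g \<in> GLgrp n \<alpha>"
  shows "(\<lambda>i. mat_inv (g i)) \<in> GLgrp n \<alpha>"
  unfolding GLgrp_def
proof (intro CollectI ballI conjI)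
  fix i assume "i \<in> {1..n}"
  then have i: "1 \<le> i" "i \<le> n" by auto
  note gi = GLgrp_D[OF assms i]
  show "mat_inv (g i) \<in> carrier_mat (\<alpha> i) (\<alpha> i)" "det (mat_inv (g i)) \<noteq> 0"
    using gi(2) by (simp_all add: mat_inv_carrier[OF gi] det_mat_inv[OF gi])
qed

lemma act_act:
  fixes g h V :: "nat \<Rightarrow> 'a::field mat"
  assumes n: "n \<ge> 1" and g: "g \<in> GLgrp n \<alpha>" and h: "h \<in> GLgrp n \<alpha>" and V: "V \<in> ORep n \<alpha>"
  shows "act n g (act n h V) = act n (\<lambda>i. g i * h i) V"
proof -
  define W where "W = act n h V"
  define X where "X = act n g W"
  have W: "W \<in> ORep n \<alpha>" unfolding W_def by (rule act_ORep[OF n h V])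
  have X: "X \<in> ORep n \<alpha>" unfolding X_def by (rule act_ORep[OF n g W])
  have "act n (\<lambda>i. g i * h i) V = X"
  proof (rule act_eqI[OF n GLgrp_mult[OF g h] V X])
    fix i assume i: "1 \<le> i" "i < n"
    have c: "g i \<in> carrier_mat (\<alpha> i) (\<alpha> i)" "h i \<in> carrier_mat (\<alpha> i) (\<alpha> i)"
        "g (Suc i) \<in> carrier_mat (\<alpha> (Suc i)) (\<alpha> (Suc i))" "h (Suc i) \<in> carrier_mat (\<alpha> (Suc i)) (\<alpha> (Suc i))"
        "V i \<in> carrier_mat (\<alpha> (Suc i)) (\<alpha> i)" "W i \<in> carrier_mat (\<alpha> (Suc i)) (\<alpha> i)"
        "X i \<in> carrier_mat (\<alpha> (Suc i)) (\<alpha> i)"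
      using i GLgrp_D(1)[OF g] GLgrp_D(1)[OF h] ORep_D(1)[OF V i] ORep_D(1)[OF W i] ORep_D(1)[OF X i] by auto
    have "g (Suc i) * h (Suc i) * V i = g (Suc i) * (W i * h i)"
      using c act_D(1)[OF n h V i] unfolding W_def[symmetric]
      by (simp add: assoc_mult_mat[of _ "\<alpha> (Suc i)" "\<alpha> (Suc i)" _ "\<alpha> (Suc i)" _ "\<alpha> i"])
    also have "\<dots> = g (Suc i) * W i * h i"
      using c by (simp add: assoc_mult_mat[of _ "\<alpha> (Suc i)" "\<alpha> (Suc i)" _ "\<alpha> i" _ "\<alpha> i"])
    also have "\<dots> = X i * g i * h i"
      using act_D(1)[OF n g W i] unfolding X_def[symmetric] by simp
    also have "\<dots> = X i * (g i * h i)"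
      using c by (simp add: assoc_mult_mat[of _ "\<alpha> (Suc i)" "\<alpha> i" _ "\<alpha> i" _ "\<alpha> i"])
    finally show "g (Suc i) * h (Suc i) * V i = X i * (g i * h i)" .
  next
    have c: "g n \<in> carrier_mat (\<alpha> n) (\<alpha> n)" "h n \<in> carrier_mat (\<alpha> n) (\<alpha> n)" "X n \<in> carrier_mat (\<alpha> n) (\<alpha> n)"
      using n GLgrp_D(1)[OF g] GLgrp_D(1)[OF h] ORep_D(2)[OF X] by auto
    have "V n = transpose_mat (h n) * (transpose_mat (g n) * X n * g n) * h n"
      using act_D(2)[OF n h V] act_D(2)[OF n g W] unfolding X_def[symmetric] W_def[symmetric] by simp
    also have "\<dots> = transpose_mat (g n * h n) * X n * (g n * h n)"
      using c by (simp add: transpose_mult[of _ "\<alpha> n" "\<alpha> n" _ "\<alpha> n"]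
          assoc_mult_mat[of _ "\<alpha> n" "\<alpha> n" _ "\<alpha> n" _ "\<alpha> n"])
    finally show "V n = transpose_mat (g n * h n) * X n * (g n * h n)" .
  qed
  then show ?thesis by (simp add: X_def W_def)
qed

lemma act_cong: "n \<ge> 1 \<Longrightarrow> (\<And>i. 1 \<le> i \<Longrightarrow> i \<le> n \<Longrightarrow> g i = h i) \<Longrightarrow> act n g V = act n h V"
  by (auto simp: act_def)

text \<open>Here \<open>k\<close> is g times the inverse of h. When the determinants of g and h
  agree, \<open>k\<close> lies in \<open>SOgrp\<close>, which lets a diagonal \<open>h\<close> stand
  in for \<open>g\<close>; in general the lemma changes the base point of an orbit.\<close>

lemma act_factor:
  fixes g h V :: "nat \<Rightarrow> 'a::field mat"
  assumes n: "n \<ge> 1" and g: "g \<in> GLgrp n \<alpha>" and h: "h \<in> GLgrp n \<alpha>" and V: "V \<in> ORep n \<alpha>"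
  obtains k where "k \<in> GLgrp n \<alpha>" "act n g V = act n k (act n h V)"
    "\<And>i. 1 \<le> i \<Longrightarrow> i \<le> n \<Longrightarrow> det (k i) = det (g i) / det (h i)"
proof
  define k where "k i = g i * mat_inv (h i)" for i
  show k: "k \<in> GLgrp n \<alpha>"
    unfolding k_def by (rule GLgrp_mult[OF g GLgrp_inverse[OF h]])
  show "det (k i) = det (g i) / det (h i)" if "1 \<le> i" "i \<le> n" for i
    using GLgrp_D[OF g that] GLgrp_D[OF h that] mat_inv_carrier[OF GLgrp_D[OF h that]]
    by (simp add: k_def det_mult det_mat_inv divide_inverse)
  have "k i * h i = g i" if "1 \<le> i" "i \<le> n" for i
  proof -
    note hi = GLgrp_D[OF h that] and gi = GLgrp_D[OF g that]
    have "k i * h i = g i * (mat_inv (h i) * h i)"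
      unfolding k_def by (rule assoc_mult_mat[OF gi(1) mat_inv_carrier[OF hi] hi(1)])
    then show ?thesis using mat_inv_left[OF hi] gi by simp
  qed
  then have "act n (\<lambda>i. k i * h i) V = act n g V" by (intro act_cong[OF n])
  then show "act n g V = act n k (act n h V)" using act_act[OF n k h V] by simp
qed

lemma act_SOgrp_ORep: "n \<ge> 1 \<Longrightarrow> g \<in> SOgrp n \<alpha> \<Longrightarrow> V \<in> ORep n \<alpha> \<Longrightarrow> act n g V \<in> ORep n \<alpha>"
  using SOgrp_subset_GLgrp by (blast intro: act_ORep)

section \<open>Polynomial functions and invariants as algebras\<close>

lemma function_algebra_poly_fun:
  "function_algebra (ORep n \<alpha>) {f :: _ \<Rightarrow> 'a::field_char_0. \<exists>p\<in>poly_fun n \<alpha>. \<forall>V\<in>ORep n \<alpha>. f V = p V}"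
proof (unfold_locales, goal_cases)
  case (1 c) then show ?case using poly_fun.const[of c n \<alpha>] by auto
next
  case (2 f h)
  then obtain p q where "p \<in> poly_fun n \<alpha>" "q \<in> poly_fun n \<alpha>"
    "\<forall>V\<in>ORep n \<alpha>. f V = p V" "\<forall>V\<in>ORep n \<alpha>. h V = q V" by auto
  then show ?case by (auto intro!: bexI[OF _ poly_fun.add[of p n \<alpha> q]])
next
  case (3 f h)
  then obtain p q where "p \<in> poly_fun n \<alpha>" "q \<in> poly_fun n \<alpha>"
    "\<forall>V\<in>ORep n \<alpha>. f V = p V" "\<forall>V\<in>ORep n \<alpha>. h V = q V" by auto
  then show ?case by (auto intro!: bexI[OF _ poly_fun.mult[of p n \<alpha> q]])
next
  case (4 f h) then show ?case by auto
qed

lemma function_algebra_OSI: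
  assumes "n \<ge> 1"
  shows "function_algebra (ORep n \<alpha>) (OSI n \<alpha> :: ((nat \<Rightarrow> 'a::field_char_0 mat) \<Rightarrow> 'a) set)"
proof -
  interpret P: function_algebra "ORep n \<alpha>" "{f :: _ \<Rightarrow> 'a. \<exists>p\<in>poly_fun n \<alpha>. \<forall>V\<in>ORep n \<alpha>. f V = p V}"
    by (rule function_algebra_poly_fun)
  show ?thesis
  proof (unfold_locales, goal_cases)
    case (1 c) then show ?case using P.const[of c] by (auto simp: OSI_def)
  next
    case (2 f h) then show ?case using P.add[of f h] by (auto simp: OSI_def)
  next
    case (3 f h) then show ?case using P.mult[of f h] by (auto simp: OSI_def)
  next
    case (4 f h)
    \<comment> \<open>\<open>h\<close> is known to agree with \<open>f\<close> only on
      \<open>ORep\<close>, so the action must not leave \<open>ORep\<close>.\<close>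
    have "h (act n g V) = h V" if "g \<in> SOgrp n \<alpha>" "V \<in> ORep n \<alpha>" for g V
      using 4 that act_SOgrp_ORep[OF assms that] unfolding OSI_def by (metis (mono_tags, lifting) mem_Collect_eq)
    then show ?case using P.cong[of f h] 4 by (auto simp: OSI_def)
  qed
qed

lemma alg_gen_subset:
  assumes "function_algebra D S" "X \<subseteq> S"
  shows "alg_gen X \<subseteq> S"
proof
  interpret function_algebra D S by fact
  show "f \<in> S" if "f \<in> alg_gen X" for f
    using that by induction (use assms(2) in \<open>auto intro: const add mult\<close>)
qed

section \<open>The generators are invariant\<close>

text \<open>The symmetric dimension vector on all \<open>2 * n\<close> vertices of the
  quiver.\<close>

definition fdim :: "nat \<Rightarrow> (nat \<Rightarrow> nat) \<Rightarrow> nat \<Rightarrow> nat" where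
  "fdim n \<alpha> k = (if k \<le> n then \<alpha> k else \<alpha> (2 * n + 1 - k))"

lemma Suc_double_diff:
  fixes k n :: nat
  assumes "n < k" "k < 2 * n"
  shows "2 * n - k \<ge> 1" "2 * n - k < n" "2 * n + 1 - k = Suc (2 * n - k)" "2 * n + 1 - Suc k = 2 * n - k"
  using assms by auto

lemma mprod_carrier:
  assumes "\<And>i. j \<le> i \<Longrightarrow> i \<le> j + k \<Longrightarrow> W i \<in> carrier_mat (d (Suc i)) (d i)"
  shows "mprod W j k \<in> carrier_mat (d (Suc (j + k))) (d j)"
  using assms
proof (induction k)
  case (Suc k)
  have "mprod W j k \<in> carrier_mat (d (Suc (j + k))) (d j)" using Suc by auto
  moreover have "W (j + Suc k) \<in> carrier_mat (d (Suc (j + Suc k))) (d (j + Suc k))" using Suc.prems by auto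
  ultimately show ?case by simp
qed auto

lemma Vfull_carrier:
  assumes V: "V \<in> ORep n \<alpha>" and "1 \<le> k" "k < 2 * n"
  shows "Vfull n V k \<in> carrier_mat (fdim n \<alpha> (Suc k)) (fdim n \<alpha> k)"
proof -
  consider "k < n" | "k = n" | "n < k" by linarith
  then show ?thesis
  proof cases
    case 3
    then show ?thesis using assms ORep_D(1)[OF V Suc_double_diff(1,2)[OF 3 assms(3)]]
      by (auto simp: Vfull_def fdim_def Suc_diff_le)
  qed (use assms ORep_D(1,2)[OF V] in \<open>auto simp: Vfull_def fdim_def\<close>)
qed

lemma mprod_Vfull_carrier:
  assumes "V \<in> ORep n \<alpha>" "1 \<le> j" "j + k < 2 * n"
  shows "mprod (Vfull n V) j k \<in> carrier_mat (fdim n \<alpha> (Suc (j + k))) (fdim n \<alpha> j)"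
  using assms by (intro mprod_carrier Vfull_carrier) auto

lemma mult_conj_mat:
  fixes G :: "'a::semiring_1 mat"
  assumes "G \<in> carrier_mat a a" "W \<in> carrier_mat a b" "H' \<in> carrier_mat b b" "H \<in> carrier_mat b b"
    "M \<in> carrier_mat b c" "K \<in> carrier_mat c c" and inv: "H' * H = 1\<^sub>m b"
  shows "(G * W * H') * (H * M * K) = G * (W * M) * K"
proof -
  have "(G * W * H') * (H * M * K) = (G * W) * (H' * (H * M * K))"
    using assms by (intro assoc_mult_mat[of _ a b _ b _ c]) auto
  also have "H' * (H * M * K) = H' * (H * (M * K))"
    using assms by (subst assoc_mult_mat[of H b b M c K c]) auto
  also have "\<dots> = (H' * H) * (M * K)"
    using assms by (intro assoc_mult_mat[of _ b b _ b _ c, symmetric]) auto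
  also have "\<dots> = M * K" using assms by (auto intro!: left_mult_one_mat)
  also have "(G * W) * (M * K) = (G * W * M) * K"
    using assms by (intro assoc_mult_mat[of _ a b _ c _ c, symmetric]) auto
  also have "G * W * M = G * (W * M)"
    using assms by (intro assoc_mult_mat[of _ a a _ b _ c]) auto
  finally show ?thesis .
qed

text \<open>\<open>\<gamma>\<close> is the group element at a vertex of the full quiver, extended
  beyond \<open>n\<close> by the rule for g at \<sigma>(x), and \<open>\<gamma>'\<close> is its
  inverse. With it every arrow of the full quiver obeys the usual rule, and the inner factors of a
  product telescope.\<close>

lemma mprod_Vfull_act:
  fixes g V :: "nat \<Rightarrow> 'a::field mat"
  defines "\<gamma> \<equiv> \<lambda>n g k. if k \<le> n then g k else transpose_mat (mat_inv (g (2 * n + 1 - k)))"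
    and "\<gamma>' \<equiv> \<lambda>n g k. if k \<le> n then mat_inv (g k) else transpose_mat (g (2 * n + 1 - k))"
  assumes n: "n \<ge> 1" and g: "g \<in> GLgrp n \<alpha>" and V: "V \<in> ORep n \<alpha>"
    and jk: "1 \<le> j" "j + k < 2 * n"
  shows "mprod (Vfull n (act n g V)) j k
    = \<gamma> n g (Suc (j + k)) * mprod (Vfull n V) j k * \<gamma>' n g j"
proof -
  have \<gamma>_carrier: "\<gamma> n g k \<in> carrier_mat (fdim n \<alpha> k) (fdim n \<alpha> k)"
    and \<gamma>'_carrier: "\<gamma>' n g k \<in> carrier_mat (fdim n \<alpha> k) (fdim n \<alpha> k)"
    and inv: "\<gamma>' n g k * \<gamma> n g k = 1\<^sub>m (fdim n \<alpha> k)" if k: "1 \<le> k" "k \<le> 2 * n" for k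
  proof -
    define l where "l = (if k \<le> n then k else 2 * n + 1 - k)"
    have "1 \<le> l" "l \<le> n" using k by (auto simp: l_def)
    note gl = GLgrp_D[OF g this]
    note h = mat_inv_carrier[OF gl]
    have "transpose_mat (g l) * transpose_mat (mat_inv (g l)) = 1\<^sub>m (\<alpha> l)"
      by (subst transpose_mult[OF h gl(1), symmetric]) (simp add: mat_inv_left[OF gl])
    then show "\<gamma> n g k \<in> carrier_mat (fdim n \<alpha> k) (fdim n \<alpha> k)"
      "\<gamma>' n g k \<in> carrier_mat (fdim n \<alpha> k) (fdim n \<alpha> k)" "\<gamma>' n g k * \<gamma> n g k = 1\<^sub>m (fdim n \<alpha> k)"
      using gl h mat_inv_left[OF gl] by (auto simp: \<gamma>_def \<gamma>'_def fdim_def l_def split: if_splits)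
  qed
  have step: "Vfull n (act n g V) k = \<gamma> n g (Suc k) * Vfull n V k * \<gamma>' n g k" if k: "1 \<le> k" "k < 2 * n" for k
  proof -
    consider "k < n" | "k = n" | "n < k" by linarith
    then show ?thesis
    proof cases
      case 3
      define l where "l = 2 * n - k"
      have l: "1 \<le> l" "l < n" "2 * n + 1 - k = Suc l" "2 * n + 1 - Suc k = l"
        using Suc_double_diff[OF 3 k(2)] by (auto simp: l_def)
      have gl: "g l \<in> carrier_mat (\<alpha> l) (\<alpha> l)" "det (g l) \<noteq> 0" using GLgrp_D[OF g, of l] l by auto
      have gS: "g (Suc l) \<in> carrier_mat (\<alpha> (Suc l)) (\<alpha> (Suc l))" using GLgrp_D(1)[OF g, of "Suc l"] l by auto
      note h = mat_inv_carrier[OF gl] and Vl = ORep_D(1)[OF V l(1,2)]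
      have "transpose_mat (g (Suc l) * V l * mat_inv (g l))
          = transpose_mat (mat_inv (g l)) * transpose_mat (g (Suc l) * V l)"
        using gS Vl h by (intro transpose_mult) auto
      also have "\<dots> = transpose_mat (mat_inv (g l)) * (transpose_mat (V l) * transpose_mat (g (Suc l)))"
        using gS Vl by (simp add: transpose_mult)
      also have "\<dots> = transpose_mat (mat_inv (g l)) * transpose_mat (V l) * transpose_mat (g (Suc l))"
        using gS Vl h by (intro assoc_mult_mat[symmetric]) auto
      finally show ?thesis using 3 l gS Vl h
        by (simp add: Vfull_def act_def \<gamma>_def \<gamma>'_def l_def[symmetric])
    qed (use k in \<open>auto simp: Vfull_def act_def \<gamma>_def \<gamma>'_def\<close>)
  qed
  show ?thesis using jk
  proof (induction k)
    case 0
    then show ?case by (simp add: step)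
  next
    case (Suc k)
    let ?W = "Vfull n V (j + Suc k)" and ?M = "mprod (Vfull n V) j k"
    have "mprod (Vfull n (act n g V)) j (Suc k)
        = (\<gamma> n g (Suc (j + Suc k)) * ?W * \<gamma>' n g (j + Suc k)) * (\<gamma> n g (Suc (j + k)) * ?M * \<gamma>' n g j)"
      using Suc step[of "j + Suc k"] by simp
    also have "\<dots> = \<gamma> n g (Suc (j + Suc k)) * (?W * ?M) * \<gamma>' n g j"
    proof (rule mult_conj_mat)
      show "?W \<in> carrier_mat (fdim n \<alpha> (Suc (j + Suc k))) (fdim n \<alpha> (j + Suc k))"
        using Suc.prems by (intro Vfull_carrier[OF V]) auto
      show "?M \<in> carrier_mat (fdim n \<alpha> (j + Suc k)) (fdim n \<alpha> j)"
        using Suc.prems mprod_Vfull_carrier[OF V, of j k] by auto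
    qed (use Suc.prems \<gamma>_carrier \<gamma>'_carrier inv in auto)
    finally show ?case by simp
  qed
qed

lemma generators_subset_OSI:
  assumes n: "n \<ge> 1"
  shows "(generators n \<alpha> :: ((nat \<Rightarrow> 'a::field_char_0 mat) \<Rightarrow> 'a) set) \<subseteq> OSI n \<alpha>"
proof -
  let ?P = "{f :: _ \<Rightarrow> 'a. \<exists>p\<in>poly_fun n \<alpha>. \<forall>V\<in>ORep n \<alpha>. f V = p V}"
  interpret P: function_algebra "ORep n \<alpha>" ?P
    by (rule function_algebra_poly_fun)
  have V_Mat: "(\<lambda>V. V k) \<in> P.Mat (\<alpha> (Suc k)) (\<alpha> k)" if "1 \<le> k" "k < n" for k
    using that by (intro P.Mat_I) (auto dest: ORep_D(1) intro: bexI[OF _ poly_fun.coord1])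
  have Vn_Mat: "(\<lambda>V. V n) \<in> P.Mat (\<alpha> n) (\<alpha> n)"
    by (intro P.Mat_I) (auto dest: ORep_D(2) intro: bexI[OF _ poly_fun.coord2])
  have Vfull_Mat: "(\<lambda>V. Vfull n V k) \<in> P.Mat (fdim n \<alpha> (Suc k)) (fdim n \<alpha> k)" if k: "1 \<le> k" "k < 2 * n" for k
  proof -
    consider "k < n" | "k = n" | "n < k" by linarith
    then show ?thesis
    proof cases
      case 3
      note l = Suc_double_diff[OF 3 k(2)]
      show ?thesis using 3 P.Mat_uminus[OF P.Mat_transpose[OF V_Mat[OF l(1,2)]]] l
        by (simp add: Vfull_def fdim_def)
    qed (use k V_Mat Vn_Mat in \<open>auto simp: Vfull_def fdim_def\<close>)
  qed
  have mprod_Mat: "(\<lambda>V. mprod (Vfull n V) j k) \<in> P.Mat (fdim n \<alpha> (Suc (j + k))) (fdim n \<alpha> j)"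
    if "1 \<le> j" "j + k < 2 * n" for j k
    using that
  proof (induction k)
    case (Suc k)
    then show ?case using P.Mat_mult[OF Vfull_Mat[of "j + Suc k"], of "\<lambda>V. mprod (Vfull n V) j k" "fdim n \<alpha> j"] by simp
  qed (use Vfull_Mat in auto)
  have SO: "g \<in> GLgrp n \<alpha>" if "g \<in> SOgrp n \<alpha>" for g :: "nat \<Rightarrow> 'a mat"
    using that SOgrp_subset_GLgrp by blast
  have det1: "det (g i) = 1" if "g \<in> SOgrp n \<alpha>" "1 \<le> i" "i \<le> n" for g :: "nat \<Rightarrow> 'a mat" and i
    using that by (auto simp: SOgrp_def)
  show ?thesis
  proof
    fix f :: "(nat \<Rightarrow> 'a mat) \<Rightarrow> 'a" assume "f \<in> generators n \<alpha>"
    then consider (det) i j where "1 \<le> j" "j \<le> i" "i \<le> n - 1" "\<alpha> j = \<alpha> (Suc i)"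
        "f = (\<lambda>V. det (mprod (Vfull n V) j (i - j)))"
      | (pf) i where "1 \<le> i" "i \<le> n" "even (\<alpha> i)" "f = (\<lambda>V. pf (mprod (Vfull n V) i (2 * n - 2 * i)))"
      unfolding generators_def by blast
    then show "f \<in> OSI n \<alpha>"
    proof cases
      case det
      have d: "fdim n \<alpha> (Suc (j + (i - j))) = \<alpha> j" "fdim n \<alpha> j = \<alpha> j"
        using det n by (auto simp: fdim_def)
      have "f \<in> ?P"
        unfolding det(5) using mprod_Mat[of j "i - j"] det n unfolding d by (intro P.det[of _ "\<alpha> j"]) auto
      moreover have "f (act n g V) = f V" if gV: "g \<in> SOgrp n \<alpha>" "V \<in> ORep n \<alpha>" for g V
      proof -
        note g = SO[OF gV(1)]
        have j: "1 \<le> j" "j \<le> n" and i: "1 \<le> Suc i" "Suc i \<le> n" using det n by auto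
        note gj = GLgrp_D[OF g j] and gi = GLgrp_D[OF g i, folded det(4)]
        have M: "mprod (Vfull n V) j (i - j) \<in> carrier_mat (\<alpha> j) (\<alpha> j)"
          using mprod_Vfull_carrier[OF gV(2), of j "i - j"] det n unfolding d by auto
        have "f (act n g V) = det (g (Suc i) * mprod (Vfull n V) j (i - j) * mat_inv (g j))"
          using det n j unfolding det(5) by (subst mprod_Vfull_act[OF n g gV(2)]) auto
        also have "\<dots> = det (g (Suc i)) * det (mprod (Vfull n V) j (i - j)) * det (mat_inv (g j))"
          using gi(1) M mat_inv_carrier[OF gj] by (simp add: det_mult[of _ "\<alpha> j"])
        also have "\<dots> = f V"
          using det1[OF gV(1) i] det1[OF gV(1) j] det_mat_inv[OF gj] unfolding det(5) by simp
        finally show ?thesis .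
      qed
      ultimately show ?thesis by (auto simp: OSI_def)
    next
      case pf
      have d: "fdim n \<alpha> (Suc (i + (2 * n - 2 * i))) = \<alpha> i" "fdim n \<alpha> i = \<alpha> i"
        using pf by (auto simp: fdim_def intro!: arg_cong[of _ _ \<alpha>])
      have "f \<in> ?P"
        unfolding pf(4) using mprod_Mat[of i "2 * n - 2 * i"] pf n unfolding d by (intro P.pf[of _ "\<alpha> i"]) auto
      moreover have "f (act n g V) = f V" if gV: "g \<in> SOgrp n \<alpha>" "V \<in> ORep n \<alpha>" for g V
      proof -
        note g = SO[OF gV(1)]
        note gi = GLgrp_D[OF g pf(1,2)]
        obtain m where m: "\<alpha> i = 2 * m" using pf(3) by (elim evenE)
        have M: "mprod (Vfull n V) i (2 * n - 2 * i) \<in> carrier_mat (2 * m) (2 * m)"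
          using mprod_Vfull_carrier[OF gV(2), of i "2 * n - 2 * i"] pf n unfolding d m by auto
        \<comment> \<open>The product ends at the mirror image of vertex \<open>i\<close>, so its
          left factor is the transpose of its right factor: it transforms by congruence.\<close>
        have "2 * n + 1 - Suc (i + (2 * n - 2 * i)) = i" "\<not> Suc (i + (2 * n - 2 * i)) \<le> n" using pf by auto
        then have "f (act n g V) = pf (transpose_mat (mat_inv (g i)) * mprod (Vfull n V) i (2 * n - 2 * i) * mat_inv (g i))"
          using pf n unfolding pf(4) by (subst mprod_Vfull_act[OF n g gV(2)]) auto
        also have "\<dots> = det (mat_inv (g i)) * f V"
          unfolding pf(4) by (rule pf_congruence[OF M mat_inv_carrier[OF gi, unfolded m]])
        also have "\<dots> = f V" using det1[OF gV(1) pf(1,2)] det_mat_inv[OF gi] by simp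
        finally show ?thesis .
      qed
      ultimately show ?thesis by (auto simp: OSI_def)
    qed
  qed
qed

section \<open>A section of the quotient map\<close>

text \<open>If \<alpha> (Suc i) < \<alpha> i, the arrow leaving \<open>i\<close> has no entry at
  level \<alpha> i - 1 and \<open>t i\<close> does not occur. In the form, the condition on
  \<open>r\<close> or \<open>s\<close> selects the plane of the last coordinate; for odd \<alpha> n
  that coordinate spans the kernel and \<open>t n\<close> does not occur either.\<close>

definition srep :: "nat \<Rightarrow> (nat \<Rightarrow> nat) \<Rightarrow> (nat \<Rightarrow> 'a::field) \<Rightarrow> nat \<Rightarrow> 'a mat" where
  "srep n \<alpha> t = (\<lambda>i.
     if 1 \<le> i \<and> i < n then
       mat (\<alpha> (Suc i)) (\<alpha> i) (\<lambda>(r, s). if r = s then (if Suc s = \<alpha> i then t i else 1) else 0)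
     else if i = n then
       mat (\<alpha> n) (\<alpha> n) (\<lambda>(r, s). jform r s * (if Suc r = \<alpha> n \<or> Suc s = \<alpha> n then t n else 1))
     else 0\<^sub>m 0 0)"

lemma srep_carrier:
  "1 \<le> i \<Longrightarrow> i < n \<Longrightarrow> srep n \<alpha> t i \<in> carrier_mat (\<alpha> (Suc i)) (\<alpha> i)"
  "srep n \<alpha> t n \<in> carrier_mat (\<alpha> n) (\<alpha> n)"
  by (auto simp: srep_def)

lemma srep_arrow:
  "1 \<le> i \<Longrightarrow> i < n \<Longrightarrow> r < \<alpha> (Suc i) \<Longrightarrow> s < \<alpha> i \<Longrightarrow>
    srep n \<alpha> t i $$ (r, s) = (if r = s then (if Suc s = \<alpha> i then t i else 1) else 0)"
  by (auto simp: srep_def)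

lemma srep_form:
  "r < \<alpha> n \<Longrightarrow> s < \<alpha> n \<Longrightarrow>
    srep n \<alpha> t n $$ (r, s) = jform r s * (if Suc r = \<alpha> n \<or> Suc s = \<alpha> n then t n else 1)"
  by (auto simp: srep_def)

lemma srep_ORep: "n \<ge> 1 \<Longrightarrow> srep n \<alpha> t \<in> ORep n \<alpha>"
proof (rule ORep_I)
  fix r s assume "r < \<alpha> n" "s < \<alpha> n"
  then show "srep n \<alpha> t n $$ (r, s) = - srep n \<alpha> t n $$ (s, r)"
    by (simp add: srep_form jform_skew[of s r] disj_commute)
qed (auto simp: srep_def)

lemma srep_mult:
  assumes "1 \<le> i" "i < n" "X \<in> carrier_mat (\<alpha> i) m" "r < \<alpha> (Suc i)" "s < m"
  shows "(srep n \<alpha> t i * X) $$ (r, s)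
    = (if r < \<alpha> i then (if Suc r = \<alpha> i then t i else 1) * X $$ (r, s) else 0)"
proof -
  have "(srep n \<alpha> t i * X) $$ (r, s) = (\<Sum>a<\<alpha> i. srep n \<alpha> t i $$ (r, a) * X $$ (a, s))"
    using assms srep_carrier(1)[of i n \<alpha> t] by (intro index_mult_mat_sum) auto
  also have "\<dots> = (\<Sum>a<\<alpha> i. if a = r then (if Suc r = \<alpha> i then t i else 1) * X $$ (r, s) else 0)"
    using assms by (intro sum.cong) (auto simp: srep_arrow)
  finally show ?thesis by simp
qed

lemma srep_transpose_mult:
  assumes "1 \<le> i" "i < n" "X \<in> carrier_mat (\<alpha> (Suc i)) m" "r < \<alpha> i" "s < m"
  shows "(transpose_mat (srep n \<alpha> t i) * X) $$ (r, s)
    = (if r < \<alpha> (Suc i) then (if Suc r = \<alpha> i then t i else 1) * X $$ (r, s) else 0)"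
proof -
  have c: "srep n \<alpha> t i \<in> carrier_mat (\<alpha> (Suc i)) (\<alpha> i)" using assms srep_carrier by auto
  have "(transpose_mat (srep n \<alpha> t i) * X) $$ (r, s)
      = (\<Sum>a<\<alpha> (Suc i). transpose_mat (srep n \<alpha> t i) $$ (r, a) * X $$ (a, s))"
    using assms c by (intro index_mult_mat_sum) auto
  also have "\<dots> = (\<Sum>a<\<alpha> (Suc i). if a = r then (if Suc r = \<alpha> i then t i else 1) * X $$ (r, s) else 0)"
    using assms c by (intro sum.cong) (auto simp: srep_arrow)
  finally show ?thesis by simp
qed

text \<open>Only levels below \<alpha> j are transported. They lie strictly below the last level of
  each later vertex whose arrow is used, so \<open>t j\<close> is the only parameter picked
  up.\<close>

lemma mprod_srep:
  assumes n: "n \<ge> 1" and "1 \<le> j" "j + k < n" "\<forall>l\<in>{j+1..j+k}. \<alpha> j < \<alpha> l"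
    and "r < \<alpha> (Suc (j + k))" "s < \<alpha> j"
  shows "mprod (Vfull n (srep n \<alpha> t)) j k $$ (r, s)
    = (if r = s then (if Suc s = \<alpha> j then t j else 1) else 0)"
  using assms(2-)
proof (induction k arbitrary: r)
  case 0
  then show ?case by (simp add: Vfull_def srep_arrow)
next
  case (Suc k)
  let ?X = "mprod (Vfull n (srep n \<alpha> t)) j k"
  have X: "?X \<in> carrier_mat (\<alpha> (j + Suc k)) (\<alpha> j)"
    using mprod_Vfull_carrier[OF srep_ORep[OF n, of \<alpha> t], of j k] Suc.prems by (auto simp: fdim_def)
  have lt: "\<alpha> j < \<alpha> (j + Suc k)" using Suc.prems(3) by auto
  have "mprod (Vfull n (srep n \<alpha> t)) j (Suc k) = srep n \<alpha> t (j + Suc k) * ?X"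
    using Suc.prems by (simp add: Vfull_def)
  then have "mprod (Vfull n (srep n \<alpha> t)) j (Suc k) $$ (r, s)
      = (if r < \<alpha> (j + Suc k) then (if Suc r = \<alpha> (j + Suc k) then t (j + Suc k) else 1) * ?X $$ (r, s) else 0)"
    using Suc.prems srep_mult[of "j + Suc k" n ?X \<alpha> "\<alpha> j" r s t] X by simp
  moreover have "?X $$ (r, s) = (if r = s then (if Suc s = \<alpha> j then t j else 1) else 0)"
    if "r < \<alpha> (j + Suc k)"
    using Suc.IH[of r] Suc.prems that by auto
  ultimately show ?case using lt Suc.prems(5) by auto
qed

lemma det_diagonal:
  "det (mat d d (\<lambda>(r, s). if r = s then x r else 0)) = (\<Prod>i<d. x i :: 'a::idom)"
proof -
  let ?A = "mat d d (\<lambda>(r, s). if r = s then x r else 0) :: 'a mat"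
  have "det ?A = prod_list (diag_mat ?A)"
    by (rule det_upper_triangular[of _ d]) auto
  also have "\<dots> = (\<Prod>i<d. x i)"
    by (simp add: prod_list_diag_prod atLeast0LessThan)
  finally show ?thesis .
qed

lemma prod_last:
  "d > 0 \<Longrightarrow> (\<Prod>i<d. if Suc i = d then x else 1) = (x :: 'a::comm_monoid_mult)"
  by (cases d) auto

lemma det_mprod_srep:
  assumes n: "n \<ge> 1" and j: "1 \<le> j" "j \<le> i" "i \<le> n - 1" and eq: "\<alpha> j = \<alpha> (Suc i)"
    and lt: "\<forall>k\<in>{j+1..i}. \<alpha> j < \<alpha> k" and pos: "\<alpha> j > 0"
  shows "det (mprod (Vfull n (srep n \<alpha> t)) j (i - j)) = t j"
proof -
  have "Suc i \<le> n" "i < 2 * n" "j \<le> n" using j n by auto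
  then have "mprod (Vfull n (srep n \<alpha> t)) j (i - j) \<in> carrier_mat (\<alpha> j) (\<alpha> j)"
    using mprod_Vfull_carrier[OF srep_ORep[OF n, of \<alpha> t], of j "i - j"] j eq by (simp add: fdim_def)
  then have "mprod (Vfull n (srep n \<alpha> t)) j (i - j)
      = mat (\<alpha> j) (\<alpha> j) (\<lambda>(r, s). if r = s then (if Suc r = \<alpha> j then t j else 1) else 0)"
    using j eq lt n by (intro eq_matI) (auto simp: mprod_srep)
  then show ?thesis using det_diagonal[of "\<alpha> j" "\<lambda>r. if Suc r = \<alpha> j then t j else 1"] prod_last[OF pos] by simp
qed

text \<open>No hyperbolic plane straddles an even cut.\<close>

lemma jform_even_bound:
  assumes "jform r s \<noteq> (0::'a::field_char_0)" "even d" "s < d"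
  shows "r < d"
proof -
  consider "s = Suc r" | "even s" "r = Suc s" using assms(1) by (auto simp: jform_nonzero_iff)
  then show ?thesis using assms(2,3) by cases (auto intro: Suc_lessI)
qed

text \<open>Since \<open>mprod W i k\<close> has k + 1 factors, index \<open>n - i\<close> already
  includes the form, and \<open>l\<close> counts the transposed arrows after it, each bringing a
  sign. As \<alpha> i is even, the levels below \<alpha> i fill whole hyperbolic planes, so the form
  does not lead out of them and the way back mirrors the way out. The second factor
  \<open>t i\<close> appears only when the way back reaches the transpose of arrow
  \<open>i\<close>.\<close>

lemma mprod_srep_through_form:
  fixes t :: "nat \<Rightarrow> 'a::field_char_0"
  assumes n: "n \<ge> 1" and i: "1 \<le> i" "i < n" and lt: "\<forall>k\<in>{i+1..n}. \<alpha> i < \<alpha> k" and even: "even (\<alpha> i)"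
    and "l \<le> n - i" "r < \<alpha> (n - l)" "s < \<alpha> i"
  shows "mprod (Vfull n (srep n \<alpha> t)) i (n - i + l) $$ (r, s)
    = (-1) ^ l * jform r s * (if Suc s = \<alpha> i then t i else 1)
      * (if l = n - i \<and> Suc r = \<alpha> i then t i else 1)"
  using assms(6-)
proof (induction l arbitrary: r)
  case 0
  define k where "k = n - i - 1"
  have k: "n - i = Suc k" "i + Suc k = n" "i + k < n" "Suc (i + k) = n" using i by (auto simp: k_def)
  let ?X = "mprod (Vfull n (srep n \<alpha> t)) i k"
  have an: "\<alpha> i < \<alpha> n" using lt i by auto
  have X: "?X \<in> carrier_mat (\<alpha> n) (\<alpha> i)"
    using mprod_Vfull_carrier[OF srep_ORep[OF n, of \<alpha> t], of i k] i k by (auto simp: fdim_def)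
  have Xe: "?X $$ (a, s) = (if a = s then (if Suc s = \<alpha> i then t i else 1) else 0)" if "a < \<alpha> n" for a
    using that lt i k 0 by (intro mprod_srep[OF n]) auto
  have "mprod (Vfull n (srep n \<alpha> t)) i (n - i) = srep n \<alpha> t n * ?X"
    unfolding k(1) mprod.simps k(2) by (simp add: Vfull_def)
  then have "mprod (Vfull n (srep n \<alpha> t)) i (n - i) $$ (r, s)
      = (\<Sum>a<\<alpha> n. srep n \<alpha> t n $$ (r, a) * ?X $$ (a, s))"
    using 0 index_mult_mat_sum[OF srep_carrier(2)[of n \<alpha> t] X] by simp
  also have "\<dots> = (\<Sum>a<\<alpha> n. if a = s then srep n \<alpha> t n $$ (r, s) * (if Suc s = \<alpha> i then t i else 1) else 0)"
    by (intro sum.cong) (auto simp: Xe)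
  also have "\<dots> = srep n \<alpha> t n $$ (r, s) * (if Suc s = \<alpha> i then t i else 1)"
    using 0 an by simp
  also have "srep n \<alpha> t n $$ (r, s) = jform r s"
  proof (cases "jform r s = (0::'a)")
    case False
    then have "r < \<alpha> i" using jform_even_bound even 0 by blast
    then show ?thesis using 0 an by (subst srep_form) auto
  qed (use 0 an in \<open>auto simp: srep_form\<close>)
  finally show ?case using i by simp
next
  case (Suc l)
  define m where "m = n - Suc l"
  have m: "i \<le> m" "m < n" "Suc m = n - l" "1 \<le> m" "2 * n - (n + Suc l) = m"
    using Suc.prems i by (auto simp: m_def)
  let ?X = "mprod (Vfull n (srep n \<alpha> t)) i (n - i + l)"
  have am: "\<alpha> i < \<alpha> (Suc m)" using lt m by auto
  have "fdim n \<alpha> (Suc (i + (n - i + l))) = \<alpha> (Suc m)"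
    using m i by (auto simp: fdim_def intro!: arg_cong[of _ _ \<alpha>])
  then have X: "?X \<in> carrier_mat (\<alpha> (Suc m)) (\<alpha> i)"
    using mprod_Vfull_carrier[OF srep_ORep[OF n, of \<alpha> t], of i "n - i + l"] i Suc.prems by (auto simp: fdim_def)
  have r: "r < \<alpha> m" using Suc.prems by (simp add: m_def)
  have idx: "i + Suc (n - i + l) = n + Suc l" using i by simp
  have "mprod (Vfull n (srep n \<alpha> t)) i (n - i + Suc l) = - transpose_mat (srep n \<alpha> t m) * ?X"
    unfolding add_Suc_right mprod.simps idx[unfolded add_Suc_right] using m by (simp add: Vfull_def)
  also have "\<dots> = - (transpose_mat (srep n \<alpha> t m) * ?X)"
    using X srep_carrier(1)[OF m(4,2), of \<alpha> t] by simp
  finally have "mprod (Vfull n (srep n \<alpha> t)) i (n - i + Suc l) $$ (r, s)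
      = - (transpose_mat (srep n \<alpha> t m) * ?X) $$ (r, s)"
    using X srep_carrier(1)[OF m(4,2), of \<alpha> t] r Suc.prems by simp
  also have "\<dots> = - (if r < \<alpha> (Suc m) then (if Suc r = \<alpha> m then t m else 1) * ?X $$ (r, s) else 0)"
    using srep_transpose_mult[of m n ?X \<alpha> "\<alpha> i" r s t] m X r Suc.prems by simp
  finally have *: "mprod (Vfull n (srep n \<alpha> t)) i (n - i + Suc l) $$ (r, s)
      = - (if r < \<alpha> (Suc m) then (if Suc r = \<alpha> m then t m else 1) * ?X $$ (r, s) else 0)" .
  have IH: "?X $$ (r, s) = (-1) ^ l * jform r s * (if Suc s = \<alpha> i then t i else 1)" if "r < \<alpha> (Suc m)"
    using Suc.IH[of r] Suc.prems that m by simp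
  show ?case
  proof (cases "jform r s = (0::'a)")
    case True
    then show ?thesis using IH unfolding * by auto
  next
    case False
    then have ri: "r < \<alpha> i" using jform_even_bound even Suc.prems by blast
    \<comment> \<open>Level \<open>r\<close> is below \<alpha> i, hence can be the last level of
      vertex \<open>m\<close> only if \<open>m = i\<close>.\<close>
    have "(if Suc r = \<alpha> m then t m else 1) = (if Suc l = n - i \<and> Suc r = \<alpha> i then t i else 1)"
    proof (cases "m = i")
      case True
      then show ?thesis using m i by (auto simp: m_def)
    next
      case False
      then have "\<alpha> i < \<alpha> m" "Suc l \<noteq> n - i" using lt m by (auto simp: m_def)
      then show ?thesis using ri by auto
    qed
    then show ?thesis unfolding * using ri am IH by simp
  qed
qed

text \<open>The parameter scales the last row and the last column, that is, it acts by a diagonal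
  congruence, and the Pfaffian keeps it once. For \<open>i = n\<close> the form carries it directly;
  a nonzero entry never has both indices last, so the same matrix results.\<close>

lemma pf_mprod_srep:
  assumes n: "n \<ge> 1" and i: "1 \<le> i" "i \<le> n" and lt: "\<forall>k\<in>{i+1..n}. \<alpha> i < \<alpha> k"
    and even: "even (\<alpha> i)" and pos: "\<alpha> i > 0"
  shows "\<exists>c::'a::field_char_0. c \<noteq> 0 \<and>
    (\<forall>t. pf (mprod (Vfull n (srep n \<alpha> t)) i (2 * n - 2 * i)) = c * t i)"
proof -
  obtain m where m: "\<alpha> i = 2 * m" using even by (elim evenE)
  define c :: 'a where "c = (-1) ^ (n - i)"
  have *: "mprod (Vfull n (srep n \<alpha> t)) i (2 * n - 2 * i)
      = mat (2 * m) (2 * m) (\<lambda>(r, s). c * jform r s * (if Suc r = 2 * m then t i else 1)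
          * (if Suc s = 2 * m then t i else 1))" for t :: "nat \<Rightarrow> 'a"
  proof (rule eq_matI, goal_cases)
    case (1 r s)
    show ?case
    proof (cases "i = n")
      case True
      have "r \<noteq> s" if "jform r s \<noteq> (0::'a)" using that by (auto simp: jform_def)
      then show ?thesis using True 1 m by (auto simp: Vfull_def srep_form c_def)
    next
      case False
      then have "n - i + (n - i) = 2 * n - 2 * i" "i < n" using i by auto
      then show ?thesis
        using mprod_srep_through_form[OF n i(1) _ lt even le_refl, of r s t] 1 i m by (simp add: c_def)
    qed
  next
    case 2
    then show ?case using mprod_Vfull_carrier[OF srep_ORep[OF n, of \<alpha> t], of i "2 * n - 2 * i"] i m
      by (auto simp: fdim_def split: if_splits)
  next
    case 3
    then show ?case using mprod_Vfull_carrier[OF srep_ORep[OF n, of \<alpha> t], of i "2 * n - 2 * i"] i m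
      by (auto simp: fdim_def)
  qed
  have "pf (mprod (Vfull n (srep n \<alpha> t)) i (2 * n - 2 * i))
      = c ^ m * pf (mat (2 * m) (2 * m) (\<lambda>(r, s). jform r s)) * t i" for t
    unfolding * pf_jform_scaled[of m c "\<lambda>r. if Suc r = 2 * m then t i else 1"]
    using prod_last[of "2 * m" "t i"] pos m by simp
  moreover have "c ^ m * pf (mat (2 * m) (2 * m) (\<lambda>(r, s). jform r s)) \<noteq> 0"
    using pf_jform_nonzero[of m, where ?'a = 'a] by (simp add: c_def)
  ultimately show ?thesis by blast
qed

section \<open>The coordinates of the section as values of generators\<close>

text \<open>For \<open>j\<close> from 1 to \<open>n\<close> this says that a generator starts at
  \<open>j\<close>. The two alternatives then exclude each other and \<open>i\<close> in the first
  is unique, so exactly one generator starts at each such vertex.\<close>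

definition free_vertex :: "nat \<Rightarrow> (nat \<Rightarrow> nat) \<Rightarrow> nat \<Rightarrow> bool" where
  "free_vertex n \<alpha> j \<longleftrightarrow>
     (\<exists>i. j \<le> i \<and> i \<le> n - 1 \<and> \<alpha> j = \<alpha> (Suc i) \<and> (\<forall>k\<in>{j+1..i}. \<alpha> j < \<alpha> k))
     \<or> (\<forall>k\<in>{j+1..n}. \<alpha> j < \<alpha> k) \<and> even (\<alpha> j)"

lemma free_vertex_generator:
  assumes n: "n \<ge> 1" and j: "1 \<le> j" "j \<le> n" and free: "free_vertex n \<alpha> j" and pos: "\<alpha> j > 0"
  shows "\<exists>f\<in>alg_gen (generators n \<alpha>). \<forall>t :: nat \<Rightarrow> 'a::field_char_0. f (srep n \<alpha> t) = t j"
  using free unfolding free_vertex_def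
proof (elim disjE exE conjE)
  fix i assume i: "j \<le> i" "i \<le> n - 1" "\<alpha> j = \<alpha> (Suc i)" "\<forall>k\<in>{j+1..i}. \<alpha> j < \<alpha> k"
  have "(\<lambda>V. det (mprod (Vfull n V) j (i - j))) \<in> (generators n \<alpha> :: ((nat \<Rightarrow> 'a mat) \<Rightarrow> 'a) set)"
    using i j unfolding generators_def by blast
  then show ?thesis using det_mprod_srep[OF n j(1) i pos] by (intro bexI[OF _ alg_gen.gen]) auto
next
  assume i: "\<forall>k\<in>{j+1..n}. \<alpha> j < \<alpha> k" "even (\<alpha> j)"
  then obtain c :: 'a where c: "c \<noteq> 0"
    "\<And>t. pf (mprod (Vfull n (srep n \<alpha> t)) j (2 * n - 2 * j)) = c * t j"
    using pf_mprod_srep[OF n j i pos, where ?'a = 'a] by auto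
  have "(\<lambda>V. pf (mprod (Vfull n V) j (2 * n - 2 * j))) \<in> (generators n \<alpha> :: ((nat \<Rightarrow> 'a mat) \<Rightarrow> 'a) set)"
    using i j unfolding generators_def by blast
  then have "(\<lambda>V. inverse c * pf (mprod (Vfull n V) j (2 * n - 2 * j))) \<in> alg_gen (generators n \<alpha>)"
    by (intro alg_gen.mult alg_gen.const alg_gen.gen)
  then show ?thesis by (rule bexI[rotated]) (use c in auto)
qed

text \<open>Only coordinates matter, by induction on the polynomial. On the section each of them is
  a constant or a constant times a single \<open>t j\<close>, which comes from a generator at a free
  vertex and is 1 at any other.\<close>

lemma poly_fun_on_section:
  fixes p :: "(nat \<Rightarrow> 'a::field_char_0 mat) \<Rightarrow> 'a"
  assumes n: "n \<ge> 1" and "p \<in> poly_fun n \<alpha>"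
  shows "\<exists>h\<in>alg_gen (generators n \<alpha>). \<forall>t. (\<forall>j. \<not> free_vertex n \<alpha> j \<longrightarrow> t j = 1) \<longrightarrow>
    p (srep n \<alpha> t) = h (srep n \<alpha> t)"
proof -
  let ?S = "{p :: (nat \<Rightarrow> 'a mat) \<Rightarrow> 'a. \<exists>h\<in>alg_gen (generators n \<alpha>).
    \<forall>t. (\<forall>j. \<not> free_vertex n \<alpha> j \<longrightarrow> t j = 1) \<longrightarrow> p (srep n \<alpha> t) = h (srep n \<alpha> t)}"
  have const: "(\<lambda>V. c) \<in> ?S" for c
    using alg_gen.const[of c "generators n \<alpha>"] by auto
  have add: "(\<lambda>V. f V + h V) \<in> ?S" if fh: "f \<in> ?S" "h \<in> ?S" for f h
  proof -
    from fh obtain f' h' where "f' \<in> alg_gen (generators n \<alpha>)" "h' \<in> alg_gen (generators n \<alpha>)"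
      "\<forall>t. (\<forall>j. \<not> free_vertex n \<alpha> j \<longrightarrow> t j = 1) \<longrightarrow> f (srep n \<alpha> t) = f' (srep n \<alpha> t)"
      "\<forall>t. (\<forall>j. \<not> free_vertex n \<alpha> j \<longrightarrow> t j = 1) \<longrightarrow> h (srep n \<alpha> t) = h' (srep n \<alpha> t)" by auto
    then show ?thesis by (auto intro!: bexI[OF _ alg_gen.add[of f' _ h']])
  qed
  have mult: "(\<lambda>V. f V * h V) \<in> ?S" if fh: "f \<in> ?S" "h \<in> ?S" for f h
  proof -
    from fh obtain f' h' where "f' \<in> alg_gen (generators n \<alpha>)" "h' \<in> alg_gen (generators n \<alpha>)"
      "\<forall>t. (\<forall>j. \<not> free_vertex n \<alpha> j \<longrightarrow> t j = 1) \<longrightarrow> f (srep n \<alpha> t) = f' (srep n \<alpha> t)"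
      "\<forall>t. (\<forall>j. \<not> free_vertex n \<alpha> j \<longrightarrow> t j = 1) \<longrightarrow> h (srep n \<alpha> t) = h' (srep n \<alpha> t)" by auto
    then show ?thesis by (auto intro!: bexI[OF _ alg_gen.mult[of f' _ h']])
  qed
  have cong: "f \<in> ?S" if "h \<in> ?S" "\<And>t. f (srep n \<alpha> t) = h (srep n \<alpha> t)" for f h
    using that by auto
  have param: "\<exists>f\<in>alg_gen (generators n \<alpha>). \<forall>t :: nat \<Rightarrow> 'a. (\<forall>j. \<not> free_vertex n \<alpha> j \<longrightarrow> t j = 1) \<longrightarrow> f (srep n \<alpha> t) = t j"
    if j: "1 \<le> j" "j \<le> n" "\<alpha> j > 0" for j
  proof (cases "free_vertex n \<alpha> j")
    case True
    from free_vertex_generator[OF n j(1,2) True j(3)] obtain f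
      where "f \<in> alg_gen (generators n \<alpha>)" "\<And>t :: nat \<Rightarrow> 'a. f (srep n \<alpha> t) = t j" by auto
    then show ?thesis by (intro bexI[of _ f]) auto
  next
    case False
    then show ?thesis using alg_gen.const[of 1] by (intro bexI[of _ "\<lambda>V. 1"]) auto
  qed
  have "p \<in> ?S" using \<open>p \<in> poly_fun n \<alpha>\<close>
  proof induction
    case (coord1 i r s)
    show ?case
    proof (cases "r = s \<and> Suc s = \<alpha> i")
      case True
      have "0 < \<alpha> i" "i \<le> n" using coord1 by auto
      from param[OF coord1(1) this(2,1)] obtain f where "f \<in> alg_gen (generators n \<alpha>)"
        "\<forall>t :: nat \<Rightarrow> 'a. (\<forall>j. \<not> free_vertex n \<alpha> j \<longrightarrow> t j = 1) \<longrightarrow> f (srep n \<alpha> t) = t i"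
        by auto
      then show ?thesis using True coord1 by (auto simp: srep_arrow intro!: bexI[of _ f])
    next
      case False
      then show ?thesis using coord1
        by (intro cong[OF const[of "if r = s then 1 else 0"]]) (auto simp: srep_arrow)
    qed
  next
    case (coord2 r s)
    show ?case
    proof (cases "Suc r = \<alpha> n \<or> Suc s = \<alpha> n")
      case True
      have "0 < \<alpha> n" using coord2 by auto
      from param[OF n le_refl this] obtain f where f: "f \<in> alg_gen (generators n \<alpha>)"
        "\<forall>t :: nat \<Rightarrow> 'a. (\<forall>j. \<not> free_vertex n \<alpha> j \<longrightarrow> t j = 1) \<longrightarrow> f (srep n \<alpha> t) = t n"
        by auto
      have "(\<lambda>V. jform r s * f V) \<in> alg_gen (generators n \<alpha>)"
        by (intro alg_gen.mult alg_gen.const f(1))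
      then show ?thesis using True coord2 f(2)
        by (auto simp: srep_form intro!: bexI[of _ "\<lambda>V. jform r s * f V"])
    next
      case False
      then show ?thesis using coord2
        by (intro cong[OF const[of "jform r s"]]) (auto simp: srep_form)
    qed
  qed (use const add mult in auto)
  then show ?thesis by blast
qed

section \<open>Vanishing on the open orbit\<close>

definition diagfam :: "(nat \<Rightarrow> nat) \<Rightarrow> (nat \<Rightarrow> nat \<Rightarrow> 'a::field) \<Rightarrow> nat \<Rightarrow> 'a mat" where
  "diagfam \<alpha> \<delta> i = mat (\<alpha> i) (\<alpha> i) (\<lambda>(r, s). if r = s then \<delta> i r else 0)"

lemma det_diagfam: "det (diagfam \<alpha> \<delta> i) = (\<Prod>r<\<alpha> i. \<delta> i r)"
  unfolding diagfam_def by (rule det_diagonal)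

lemma diagfam_GLgrp:
  assumes "\<And>i r. 1 \<le> i \<Longrightarrow> i \<le> n \<Longrightarrow> r < \<alpha> i \<Longrightarrow> \<delta> i r \<noteq> 0"
  shows "diagfam \<alpha> \<delta> \<in> GLgrp n \<alpha>"
  unfolding GLgrp_def using assms by (auto simp: det_diagfam) (auto simp: diagfam_def)

lemma diagfam_mult:
  assumes "X \<in> carrier_mat (\<alpha> i) m" "r < \<alpha> i" "s < m"
  shows "(diagfam \<alpha> \<delta> i * X) $$ (r, s) = \<delta> i r * X $$ (r, s)"
proof -
  have "(diagfam \<alpha> \<delta> i * X) $$ (r, s) = (\<Sum>a<\<alpha> i. diagfam \<alpha> \<delta> i $$ (r, a) * X $$ (a, s))"
    using assms by (intro index_mult_mat_sum) (auto simp: diagfam_def)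
  also have "\<dots> = (\<Sum>a<\<alpha> i. if a = r then \<delta> i r * X $$ (r, s) else 0)"
    using assms by (intro sum.cong) (auto simp: diagfam_def)
  finally show ?thesis using assms by simp
qed

lemma mult_diagfam:
  assumes "X \<in> carrier_mat m (\<alpha> i)" "r < m" "s < \<alpha> i"
  shows "(X * diagfam \<alpha> \<delta> i) $$ (r, s) = X $$ (r, s) * \<delta> i s"
proof -
  have "(X * diagfam \<alpha> \<delta> i) $$ (r, s) = (\<Sum>a<\<alpha> i. X $$ (r, a) * diagfam \<alpha> \<delta> i $$ (a, s))"
    using assms by (intro index_mult_mat_sum) (auto simp: diagfam_def)
  also have "\<dots> = (\<Sum>a<\<alpha> i. if a = s then X $$ (r, s) * \<delta> i s else 0)"
    using assms by (intro sum.cong) (auto simp: diagfam_def)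
  finally show ?thesis using assms by simp
qed

text \<open>For diagonal elements the intertwining equations are scalar, one per level: the scale is
  constant along a chain except where a parameter sits, and the two scales on a hyperbolic plane
  account for the change of its parameter.\<close>

lemma act_diagfam_srep:
  fixes t t' :: "nat \<Rightarrow> 'a::field_char_0"
  assumes n: "n \<ge> 1" and nz: "\<And>i r. 1 \<le> i \<Longrightarrow> i \<le> n \<Longrightarrow> r < \<alpha> i \<Longrightarrow> \<delta> i r \<noteq> 0"
    and arrow: "\<And>j r. 1 \<le> j \<Longrightarrow> j < n \<Longrightarrow> r < \<alpha> j \<Longrightarrow> r < \<alpha> (Suc j) \<Longrightarrow>
      \<delta> (Suc j) r * (if Suc r = \<alpha> j then t j else 1) = (if Suc r = \<alpha> j then t' j else 1) * \<delta> j r"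
    and form: "\<And>r s. r < \<alpha> n \<Longrightarrow> s < \<alpha> n \<Longrightarrow> jform r s \<noteq> (0::'a) \<Longrightarrow>
      (if Suc r = \<alpha> n \<or> Suc s = \<alpha> n then t n else 1)
      = \<delta> n r * \<delta> n s * (if Suc r = \<alpha> n \<or> Suc s = \<alpha> n then t' n else 1)"
  shows "act n (diagfam \<alpha> \<delta>) (srep n \<alpha> t) = srep n \<alpha> t'"
proof (rule act_eqI[OF n diagfam_GLgrp srep_ORep[OF n] srep_ORep[OF n]])
  fix j assume j: "1 \<le> j" "j < n"
  show "diagfam \<alpha> \<delta> (Suc j) * srep n \<alpha> t j = srep n \<alpha> t' j * diagfam \<alpha> \<delta> j"
  proof (rule eq_matI)
    fix r s assume "r < dim_row (srep n \<alpha> t' j * diagfam \<alpha> \<delta> j)" "s < dim_col (srep n \<alpha> t' j * diagfam \<alpha> \<delta> j)"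
    then have rs: "r < \<alpha> (Suc j)" "s < \<alpha> j" using srep_carrier(1)[OF j, of \<alpha> t'] by (auto simp: diagfam_def)
    have "(diagfam \<alpha> \<delta> (Suc j) * srep n \<alpha> t j) $$ (r, s) = \<delta> (Suc j) r * srep n \<alpha> t j $$ (r, s)"
      by (rule diagfam_mult) (rule srep_carrier(1)[OF j] rs)+
    moreover have "(srep n \<alpha> t' j * diagfam \<alpha> \<delta> j) $$ (r, s) = srep n \<alpha> t' j $$ (r, s) * \<delta> j s"
      by (rule mult_diagfam) (rule srep_carrier(1)[OF j] rs)+
    ultimately show "(diagfam \<alpha> \<delta> (Suc j) * srep n \<alpha> t j) $$ (r, s) = (srep n \<alpha> t' j * diagfam \<alpha> \<delta> j) $$ (r, s)"
      using arrow[OF j rs(2)] rs by (simp add: srep_arrow[OF j rs])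
  qed (use srep_carrier(1)[OF j, of \<alpha> t] srep_carrier(1)[OF j, of \<alpha> t'] in \<open>auto simp: diagfam_def\<close>)
next
  have t: "transpose_mat (diagfam \<alpha> \<delta> n) = diagfam \<alpha> \<delta> n"
    by (rule eq_matI) (auto simp: diagfam_def)
  have c: "diagfam \<alpha> \<delta> n \<in> carrier_mat (\<alpha> n) (\<alpha> n)" by (simp add: diagfam_def)
  note S = srep_carrier(2)[of n \<alpha> t']
  show "srep n \<alpha> t n = transpose_mat (diagfam \<alpha> \<delta> n) * srep n \<alpha> t' n * diagfam \<alpha> \<delta> n"
    unfolding t
  proof (rule eq_matI)
    fix r s assume "r < dim_row (diagfam \<alpha> \<delta> n * srep n \<alpha> t' n * diagfam \<alpha> \<delta> n)"
      "s < dim_col (diagfam \<alpha> \<delta> n * srep n \<alpha> t' n * diagfam \<alpha> \<delta> n)"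
    then have rs: "r < \<alpha> n" "s < \<alpha> n" by (auto simp: diagfam_def)
    have "(diagfam \<alpha> \<delta> n * srep n \<alpha> t' n * diagfam \<alpha> \<delta> n) $$ (r, s)
        = \<delta> n r * srep n \<alpha> t' n $$ (r, s) * \<delta> n s"
      using mult_diagfam[of "diagfam \<alpha> \<delta> n * srep n \<alpha> t' n" "\<alpha> n" \<alpha> n r s \<delta>] c S rs
      by (simp add: diagfam_mult[of _ \<alpha> n "\<alpha> n", OF S rs] del: index_mult_mat)
    then show "srep n \<alpha> t n $$ (r, s) = (diagfam \<alpha> \<delta> n * srep n \<alpha> t' n * diagfam \<alpha> \<delta> n) $$ (r, s)"
      using form[OF rs] rs by (cases "jform r s = (0::'a)") (simp_all add: srep_form mult_ac)
  qed (use srep_carrier(2)[of n \<alpha> t] in \<open>auto simp: diagfam_def\<close>)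
qed (use nz in auto)

lemma OSI_invariant:
  "F \<in> OSI n \<alpha> \<Longrightarrow> g \<in> SOgrp n \<alpha> \<Longrightarrow> V \<in> ORep n \<alpha> \<Longrightarrow> F (act n g V) = F V"
  by (auto simp: OSI_def)

lemma srep_cong:
  assumes "n \<ge> 1" "\<And>j. 1 \<le> j \<Longrightarrow> j \<le> n \<Longrightarrow> t j = t' j"
  shows "srep n \<alpha> t = srep n \<alpha> t'"
  using assms by (auto simp: srep_def fun_eq_iff)

text \<open>A parameter at a vertex that is not free sits on a chain of basis vectors which, just above
  it, is accompanied by a chain of exactly the same length without its initial vertex. Scaling the
  two by inverse factors has determinant one and absorbs the parameter.\<close>

lemma OSI_srep_reset:
  fixes t :: "nat \<Rightarrow> 'a::field_char_0"
  assumes n: "n \<ge> 1" and F: "F \<in> OSI n \<alpha>" and j: "1 \<le> j" "j \<le> n"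
    and nonfree: "\<not> free_vertex n \<alpha> j" and tj: "t j \<noteq> 0"
  shows "F (srep n \<alpha> t) = F (srep n \<alpha> (t(j := 1)))"
proof -
  define d where "d = \<alpha> j"
  consider (n) "j = n" | (small) "j < n" "\<alpha> (Suc j) < d \<or> d = 0" | (big) "j < n" "d < \<alpha> (Suc j)" "d > 0"
  proof -
    have "\<alpha> (Suc j) \<noteq> d" if "j < n"
    proof
      assume "\<alpha> (Suc j) = d"
      then have "free_vertex n \<alpha> j" unfolding free_vertex_def d_def using that by (intro disjI1 exI[of _ j]) auto
      then show False using nonfree by simp
    qed
    then show ?thesis using that j by (metis le_neq_implies_less linorder_neqE_nat gr0I)
  qed
  then show ?thesis
  proof cases
    case n
    \<comment> \<open>The last basis vector then lies in the kernel of the form, so no nonzero entry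
      carries \<open>t n\<close>.\<close>
    have "odd (\<alpha> n)" using nonfree unfolding free_vertex_def n by auto
    then have "jform r s = (0::'a)" if "r < \<alpha> n" "s < \<alpha> n" "Suc r = \<alpha> n \<or> Suc s = \<alpha> n" for r s
      using that by (cases "Suc r = \<alpha> n"; cases "Suc s = \<alpha> n") (auto simp: jform_def elim!: oddE evenE, presburger+)
    then have "srep n \<alpha> t = srep n \<alpha> (t(j := 1))"
      unfolding n by (auto simp: srep_def fun_eq_iff intro!: eq_matI)
    then show ?thesis by simp
  next
    case small
    \<comment> \<open>The matrix has no position at which \<open>t j\<close> could stand.\<close>
    then have "srep n \<alpha> t = srep n \<alpha> (t(j := 1))"
      by (auto simp: srep_def fun_eq_iff d_def intro!: eq_matI)
    then show ?thesis by simp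
  next
    case big
    define c where "c = inverse (t j)"
    have c: "c \<noteq> 0" "c * t j = 1" using tj by (auto simp: c_def)
    \<comment> \<open>On the stretch \<open>B\<close> after \<open>j\<close>, the levels
      \<open>d - 1\<close> and \<open>d\<close> both exist. Level \<open>d\<close> is the companion
      chain: it begins only at \<open>Suc j\<close>, because \<alpha> j = d, and so it does not meet
      arrow \<open>j\<close>.\<close>
    define B where "B k \<longleftrightarrow> j < k \<and> (\<forall>l\<in>{j+1..k}. d < \<alpha> l)" for k
    define \<delta> where "\<delta> k r = (if B k then (if r = d - 1 then c else 1) * (if r = d then inverse c else 1) else 1)" for k r
    have nz: "\<delta> k r \<noteq> 0" for k r using c by (auto simp: \<delta>_def)
    have "det (diagfam \<alpha> \<delta> k) = 1" for k
    proof (cases "B k")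
      case True
      then have "d < \<alpha> k" by (auto simp: B_def)
      then show ?thesis using True c big(3) by (simp add: det_diagfam \<delta>_def prod.distrib prod.delta)
    qed (simp add: det_diagfam \<delta>_def)
    then have SO: "diagfam \<alpha> \<delta> \<in> SOgrp n \<alpha>"
      by (auto simp: SOgrp_def diagfam_def)
    have "act n (diagfam \<alpha> \<delta>) (srep n \<alpha> t) = srep n \<alpha> (t(j := 1))"
    proof (rule act_diagfam_srep[OF n nz])
      fix k r assume k: "1 \<le> k" "k < n" "r < \<alpha> k" "r < \<alpha> (Suc k)"
      consider "k < j" | "k = j" | "k > j" "B (Suc k)" | "k > j" "\<not> B k" | "k > j" "B k" "\<not> B (Suc k)"
        by linarith
      then show "\<delta> (Suc k) r * (if Suc r = \<alpha> k then t k else 1)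
        = (if Suc r = \<alpha> k then (t(j := 1)) k else 1) * \<delta> k r"
      proof cases
        case 1
        then show ?thesis by (auto simp: \<delta>_def B_def)
      next
        case 2
        then have "B (Suc k)" "\<not> B k" using big by (auto simp: B_def)
        then show ?thesis using 2 k c big(3) by (auto simp: \<delta>_def d_def)
      next
        case 3
        then have "B k" by (auto simp: B_def)
        then show ?thesis using 3 by (simp add: \<delta>_def)
      next
        case 4
        then have "\<not> B (Suc k)" by (auto simp: B_def)
        then show ?thesis using 4 by (simp add: \<delta>_def)
      next
        case 5
        \<comment> \<open>The stretch ends at \<open>k\<close>. Equality of \<alpha> (Suc k) with
          \<open>d\<close> would give a determinant starting at \<open>j\<close>; hence both chains
          stop at the same vertex and neither scaled level passes through arrow
          \<open>k\<close>.\<close>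
        then have "\<not> d < \<alpha> (Suc k)" by (auto simp: B_def le_Suc_eq)
        moreover have "\<alpha> (Suc k) \<noteq> d"
        proof
          assume "\<alpha> (Suc k) = d"
          then have "free_vertex n \<alpha> j" unfolding free_vertex_def
            using 5 k by (intro disjI1 exI[of _ k]) (auto simp: d_def B_def)
          then show False using nonfree by simp
        qed
        ultimately have "r < d - 1" using k by linarith
        then show ?thesis using 5 by (simp add: \<delta>_def)
      qed
    next
      fix r s assume rs: "r < \<alpha> n" "s < \<alpha> n" "jform r s \<noteq> (0::'a)"
      have "\<delta> n r * \<delta> n s = 1"
      proof (cases "B n")
        case True
        \<comment> \<open>If the stretch reaches the form, even \<open>d\<close> would give a
          Pfaffian starting at \<open>j\<close>. For odd \<open>d\<close> the levels
          \<open>d - 1\<close> and \<open>d\<close> span one hyperbolic plane, on which the inverse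
          scalings cancel.\<close>
        then have "odd d" using nonfree unfolding free_vertex_def by (auto simp: B_def d_def)
        moreover from rs(3) have "even r \<and> s = Suc r \<or> even s \<and> r = Suc s" by (simp add: jform_nonzero_iff)
        ultimately have "r = d - 1 \<longleftrightarrow> s = d" "s = d - 1 \<longleftrightarrow> r = d" by presburger+
        moreover have "\<not> (r = d - 1 \<and> r = d)" "\<not> (s = d - 1 \<and> s = d)" using big(3) by auto
        ultimately show ?thesis using True c big(3) by (auto simp: \<delta>_def)
      qed (simp add: \<delta>_def)
      then show "(if Suc r = \<alpha> n \<or> Suc s = \<alpha> n then t n else 1)
        = \<delta> n r * \<delta> n s * (if Suc r = \<alpha> n \<or> Suc s = \<alpha> n then (t(j := 1)) n else 1)"
        using big(1) by simp
    qed
    then show ?thesis using OSI_invariant[OF F SO srep_ORep[OF n], of t] by simp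
  qed
qed

lemma OSI_srep_vanish:
  fixes t :: "nat \<Rightarrow> 'a::field_char_0"
  assumes n: "n \<ge> 1" and F: "F \<in> OSI n \<alpha>"
    and zero: "\<And>t. (\<And>j. \<not> free_vertex n \<alpha> j \<Longrightarrow> t j = 1) \<Longrightarrow> F (srep n \<alpha> t) = 0"
    and nz: "\<And>j. t j \<noteq> 0"
  shows "F (srep n \<alpha> t) = 0"
proof -
  have reset: "F (srep n \<alpha> t) = F (srep n \<alpha> (\<lambda>j. if j \<in> J then 1 else t j))"
    if "finite J" "J \<subseteq> {j. 1 \<le> j \<and> j \<le> n \<and> \<not> free_vertex n \<alpha> j}" for J
    using that
  proof (induction J rule: finite_induct)
    case (insert j J)
    have "(\<lambda>i. if i \<in> insert j J then 1 else t i) = (\<lambda>i. if i \<in> J then 1 else t i)(j := 1)" by auto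
    then show ?case
      using insert OSI_srep_reset[OF n F, of j "\<lambda>i. if i \<in> J then 1 else t i"] nz by simp
  qed simp
  have "F (srep n \<alpha> t) = F (srep n \<alpha> (\<lambda>j. if j \<in> {j. 1 \<le> j \<and> j \<le> n \<and> \<not> free_vertex n \<alpha> j} then 1 else t j))"
    by (rule reset) auto
  also have "srep n \<alpha> (\<lambda>j. if j \<in> {j. 1 \<le> j \<and> j \<le> n \<and> \<not> free_vertex n \<alpha> j} then 1 else t j)
      = srep n \<alpha> (\<lambda>j. if free_vertex n \<alpha> j then t j else 1)"
    by (rule srep_cong[OF n]) auto
  also have "F \<dots> = 0" by (rule zero) simp
  finally show ?thesis .
qed

text \<open>The value at \<open>Suc i\<close> belongs to vertex \<open>n - i\<close>; the value at \<open>0\<close> to a fictitious vertex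
  \<open>n + 1\<close>. Entries are carried over along the chains, and the last one is adjusted so that the
  determinant becomes \<open>\<tau> (n - i)\<close>.\<close>

primrec diag_lift :: "nat \<Rightarrow> (nat \<Rightarrow> nat) \<Rightarrow> (nat \<Rightarrow> 'a::field) \<Rightarrow> nat \<Rightarrow> nat \<Rightarrow> 'a" where
  "diag_lift n \<alpha> \<tau> 0 = (\<lambda>r. 1)"
| "diag_lift n \<alpha> \<tau> (Suc i) = (\<lambda>r.
     let b = (\<lambda>r. if r < \<alpha> (Suc (n - i)) then diag_lift n \<alpha> \<tau> i r else 1)
     in if Suc r = \<alpha> (n - i) then \<tau> (n - i) / (\<Prod>q<r. b q) else b r)"

lemma diag_lift_nonzero:
  assumes "\<And>j. 1 \<le> j \<Longrightarrow> j \<le> n \<Longrightarrow> \<tau> j \<noteq> 0" "i \<le> n"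
  shows "diag_lift n \<alpha> \<tau> i r \<noteq> 0"
  using assms(2) by (induction i arbitrary: r) (auto simp: Let_def assms(1))

lemma diag_lift_prod:
  assumes "\<And>j. 1 \<le> j \<Longrightarrow> j \<le> n \<Longrightarrow> \<tau> j \<noteq> 0" "i < n" "\<alpha> (n - i) = 0 \<Longrightarrow> \<tau> (n - i) = 1"
  shows "(\<Prod>r<\<alpha> (n - i). diag_lift n \<alpha> \<tau> (Suc i) r) = \<tau> (n - i)"
proof (cases "\<alpha> (n - i)")
  case (Suc d)
  define b where "b r = (if r < \<alpha> (Suc (n - i)) then diag_lift n \<alpha> \<tau> i r else 1)" for r
  have nz: "(\<Prod>q<d. b q) \<noteq> 0" using diag_lift_nonzero[OF assms(1)] assms(2) by (simp add: b_def)
  have "(\<Prod>r<d. diag_lift n \<alpha> \<tau> (Suc i) r) = (\<Prod>q<d. b q)"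
    using Suc by (intro prod.cong) (auto simp: b_def)
  moreover have "diag_lift n \<alpha> \<tau> (Suc i) d = \<tau> (n - i) / (\<Prod>q<d. b q)"
    using Suc by (simp add: b_def)
  ultimately show ?thesis using Suc nz by (simp del: diag_lift.simps)
qed (use assms(3) in simp)

text \<open>A diagonal element with the same determinants as \<open>g\<close> moves the standard
  representation to a point of the section. The quotient of the two has determinant one at every
  vertex, so \<open>F\<close> takes the same value at both images.\<close>

lemma OSI_vanish_open_orbit:
  fixes F :: "(nat \<Rightarrow> 'a::field_char_0 mat) \<Rightarrow> 'a"
  assumes n: "n \<ge> 1" and F: "F \<in> OSI n \<alpha>"
    and zero: "\<And>t. (\<And>j. \<not> free_vertex n \<alpha> j \<Longrightarrow> t j = 1) \<Longrightarrow> F (srep n \<alpha> t) = 0"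
    and g: "g \<in> GLgrp n \<alpha>"
  shows "F (act n g (srep n \<alpha> (\<lambda>_. 1))) = 0"
proof -
  define \<tau> where "\<tau> j = det (g j)" for j
  define \<delta> where "\<delta> j = diag_lift n \<alpha> \<tau> (Suc (n - j))" for j
  \<comment> \<open>The parameter absorbs the mismatch, at the last level of \<open>j\<close>,
    between the scale inherited from the right and the scale that adjusts the determinant.
    \<open>diag_lift\<close> at \<open>n - j\<close> belongs to vertex \<open>Suc j\<close>.\<close>
  define t where "t j = (if 1 \<le> j \<and> j \<le> n then diag_lift n \<alpha> \<tau> (n - j) (\<alpha> j - 1) / \<delta> j (\<alpha> j - 1) else 1)" for j
  have \<tau>: "\<tau> j \<noteq> 0" if "1 \<le> j" "j \<le> n" for j
    using GLgrp_D(2)[OF g that] by (simp add: \<tau>_def)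
  have nz: "\<delta> j r \<noteq> 0" if "1 \<le> j" for j r
    unfolding \<delta>_def by (rule diag_lift_nonzero[OF \<tau>]) (use n that in auto)
  have tnz: "t j \<noteq> 0" for j
    using nz diag_lift_nonzero[of n \<tau> "n - j" \<alpha>] \<tau> by (simp add: t_def)
  have det: "det (diagfam \<alpha> \<delta> j) = det (g j)" if j: "1 \<le> j" "j \<le> n" for j
  proof -
    \<comment> \<open>At a vertex of dimension 0 there is no entry to adjust, but the empty
      determinant is already 1.\<close>
    have "\<tau> j = 1" if "\<alpha> j = 0" using GLgrp_D(1)[OF g j] that by (simp add: \<tau>_def)
    then show ?thesis
      using diag_lift_prod[of n \<tau> "n - j" \<alpha>] \<tau> j by (simp add: det_diagfam \<delta>_def \<tau>_def del: diag_lift.simps)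
  qed
  have GL: "diagfam \<alpha> \<delta> \<in> GLgrp n \<alpha>" using nz by (intro diagfam_GLgrp) auto
  have act: "act n (diagfam \<alpha> \<delta>) (srep n \<alpha> (\<lambda>_. 1)) = srep n \<alpha> t"
  proof (rule act_diagfam_srep[OF n nz])
    fix j r assume j: "1 \<le> j" "j < n" "r < \<alpha> j" "r < \<alpha> (Suc j)"
    have S: "\<delta> (Suc j) = diag_lift n \<alpha> \<tau> (n - j)" using j by (simp add: \<delta>_def Suc_diff_Suc del: diag_lift.simps)
    show "\<delta> (Suc j) r * (if Suc r = \<alpha> j then 1 else 1) = (if Suc r = \<alpha> j then t j else 1) * \<delta> j r"
    proof (cases "Suc r = \<alpha> j")
      case True
      then have "r = \<alpha> j - 1" by simp
      then show ?thesis using True j nz[of j] by (simp add: t_def S)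
    next
      case False
      have "\<delta> j r = diag_lift n \<alpha> \<tau> (n - j) r" using False j by (simp add: \<delta>_def)
      then show ?thesis using False by (simp add: S)
    qed
  next
    fix r s assume rs: "r < \<alpha> n" "s < \<alpha> n" "jform r s \<noteq> (0::'a)"
    have ne: "r \<noteq> s" using rs by (auto simp: jform_def)
    have 1: "\<delta> n q = 1" if "Suc q \<noteq> \<alpha> n" for q using that by (simp add: \<delta>_def)
    have last: "\<delta> n q * t n = 1" if "Suc q = \<alpha> n" for q
    proof -
      have "q = \<alpha> n - 1" using that by simp
      then show ?thesis using n nz[of n q] by (simp add: t_def)
    qed
    show "(if Suc r = \<alpha> n \<or> Suc s = \<alpha> n then 1 else 1)
      = \<delta> n r * \<delta> n s * (if Suc r = \<alpha> n \<or> Suc s = \<alpha> n then t n else 1)"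
      using 1[of r] 1[of s] last[of r] last[of s] ne by (cases "Suc r = \<alpha> n"; cases "Suc s = \<alpha> n") auto
  qed auto
  obtain k where k: "k \<in> GLgrp n \<alpha>"
    "act n g (srep n \<alpha> (\<lambda>_. 1)) = act n k (act n (diagfam \<alpha> \<delta>) (srep n \<alpha> (\<lambda>_. 1)))"
    "\<And>i. 1 \<le> i \<Longrightarrow> i \<le> n \<Longrightarrow> det (k i) = det (g i) / det (diagfam \<alpha> \<delta> i)"
    using act_factor[OF n g GL srep_ORep[OF n]] by metis
  have "k \<in> SOgrp n \<alpha>"
    using k(1,3) GLgrp_D[OF g] by (auto simp: SOgrp_def GLgrp_def det)
  then have "F (act n k (srep n \<alpha> t)) = F (srep n \<alpha> t)"
    by (rule OSI_invariant[OF F _ srep_ORep[OF n]])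
  also have "\<dots> = 0" by (rule OSI_srep_vanish[OF n F zero tnz])
  finally show ?thesis by (simp add: k(2) act)
qed

section \<open>Density of the open orbit\<close>

definition line :: "(nat \<Rightarrow> 'a::field mat) \<Rightarrow> (nat \<Rightarrow> 'a mat) \<Rightarrow> 'a \<Rightarrow> nat \<Rightarrow> 'a mat" where
  "line V W x = (\<lambda>i. V i + x \<cdot>\<^sub>m (W i - V i))"

lemma line_index:
  assumes "V i \<in> carrier_mat l m" "W i \<in> carrier_mat l m" "r < l" "s < m"
  shows "line V W x i $$ (r, s) = V i $$ (r, s) + x * (W i $$ (r, s) - V i $$ (r, s))"
  using assms by (simp add: line_def)

lemma line_carrier:
  "V i \<in> carrier_mat l m \<Longrightarrow> W i \<in> carrier_mat l m \<Longrightarrow> line V W x i \<in> carrier_mat l m"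
  unfolding line_def by (intro add_carrier_mat smult_carrier_mat minus_carrier_mat)

lemma line_ORep:
  assumes V: "V \<in> ORep n \<alpha>" and W: "W \<in> ORep n \<alpha>"
  shows "line V W x \<in> ORep n \<alpha>"
proof (rule ORep_I)
  fix r s assume rs: "r < \<alpha> n" "s < \<alpha> n"
  note idx = line_index[of V n "\<alpha> n" "\<alpha> n" W, OF ORep_D(2)[OF V] ORep_D(2)[OF W]]
  show "line V W x n $$ (r, s) = - line V W x n $$ (s, r)"
    unfolding idx[OF rs] idx[OF rs(2,1)] ORep_D(4)[OF V rs] ORep_D(4)[OF W rs]
    by (simp add: algebra_simps)
next
  fix i assume "i \<notin> {1..n}"
  then show "line V W x i = 0\<^sub>m 0 0"
    using ORep_D(3)[OF V] ORep_D(3)[OF W] by (auto simp: line_def)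
qed (auto intro!: line_carrier ORep_D(1,2)[OF V] ORep_D(1,2)[OF W])

lemma line_eq:
  assumes "V i = W i" "V i \<in> carrier_mat l m"
  shows "line V W x i = V i"
  using assms by (intro eq_matI) (auto simp: line_def)

lemma line_0:
  assumes V: "V \<in> ORep n \<alpha>" and W: "W \<in> ORep n \<alpha>"
  shows "line V W 0 = V"
proof
  fix i
  have "dim_row (V i) = dim_row (W i) \<and> dim_col (V i) = dim_col (W i)"
  proof -
    consider "1 \<le> i" "i < n" | "i = n" | "i \<notin> {1..n}" by fastforce
    then show ?thesis
      using ORep_D(1)[OF V, of i] ORep_D(1)[OF W, of i] ORep_D(2)[OF V] ORep_D(2)[OF W]
        ORep_D(3)[OF V, of i] ORep_D(3)[OF W, of i]
      by cases auto
  qed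
  then show "line V W 0 i = V i" by (intro eq_matI) (auto simp: line_def)
qed

section \<open>Invariants along lines\<close>

lemma function_algebra_poly:
  "function_algebra UNIV {f. \<exists>q. \<forall>x::'a::field_char_0. f x = poly q x}"
proof (unfold_locales, goal_cases)
  case (1 c) show ?case by (auto intro!: exI[of _ "[:c:]"])
next
  case (2 f h)
  then obtain p q where "\<forall>x. f x = poly p x" "\<forall>x. h x = poly q x" by auto
  then show ?case by (auto intro!: exI[of _ "p + q"])
next
  case (3 f h)
  then obtain p q where "\<forall>x. f x = poly p x" "\<forall>x. h x = poly q x" by auto
  then show ?case by (auto intro!: exI[of _ "p * q"])
next
  case (4 f h) then show ?case by auto
qed

lemma line_entry_poly:
  assumes "V i \<in> carrier_mat l m" "W i \<in> carrier_mat l m" "r < l" "s < m"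
  shows "(\<lambda>x. line V W x i $$ (r, s)) \<in> {f. \<exists>q. \<forall>x::'a::field_char_0. f x = poly q x}"
  unfolding line_index[of V i l m W r s, OF assms]
  by (rule CollectI, rule exI[of _ "[:V i $$ (r, s), W i $$ (r, s) - V i $$ (r, s):]"]) simp

text \<open>The element \<open>g\<close> is fixed, so its inverses contribute constants, and the
  coordinates of the translated line are polynomials in the line parameter.\<close>

lemma OSI_line_poly:
  fixes F :: "(nat \<Rightarrow> 'a::field_char_0 mat) \<Rightarrow> 'a"
  assumes n: "n \<ge> 1" and F: "F \<in> OSI n \<alpha>" and V: "V \<in> ORep n \<alpha>" and W: "W \<in> ORep n \<alpha>"
    and g: "g \<in> GLgrp n \<alpha>"
  shows "\<exists>q. \<forall>x. F (act n g (line V W x)) = poly q x"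
proof -
  let ?L = "{f. \<exists>q. \<forall>x::'a. f x = poly q x}"
  interpret L: function_algebra UNIV ?L by (rule function_algebra_poly)
  have inv: "mat_inv (g i) \<in> carrier_mat (\<alpha> i) (\<alpha> i)" if "1 \<le> i" "i \<le> n" for i
    by (rule mat_inv_carrier[OF GLgrp_D[OF g that]])
  have "(\<lambda>x. line V W x i) \<in> L.Mat (\<alpha> (Suc i)) (\<alpha> i)" if i: "1 \<le> i" "i < n" for i
    by (intro L.Mat_I line_carrier line_entry_poly) (auto intro: ORep_D(1)[OF V i] ORep_D(1)[OF W i])
  then have arrow: "(\<lambda>x. act n g (line V W x) i) \<in> L.Mat (\<alpha> (Suc i)) (\<alpha> i)" if i: "1 \<le> i" "i < n" for i
    using i inv[of i] GLgrp_D(1)[OF g, of "Suc i"] unfolding act_def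
    by (auto intro!: L.Mat_mult L.Mat_const)
  have "(\<lambda>x. line V W x n) \<in> L.Mat (\<alpha> n) (\<alpha> n)"
    by (intro L.Mat_I line_carrier line_entry_poly) (auto intro: ORep_D(2)[OF V] ORep_D(2)[OF W])
  then have form: "(\<lambda>x. act n g (line V W x) n) \<in> L.Mat (\<alpha> n) (\<alpha> n)"
    using n inv[of n] unfolding act_def by (auto intro!: L.Mat_mult L.Mat_const)
  obtain p where p: "p \<in> poly_fun n \<alpha>" "\<And>V. V \<in> ORep n \<alpha> \<Longrightarrow> F V = p V"
    using F by (auto simp: OSI_def)
  have "(\<lambda>x. p (act n g (line V W x))) \<in> ?L" using p(1)
  proof induction
    case (coord1 i r s)
    then show ?case by (intro L.Mat_entry[OF arrow])
  next
    case (coord2 r s)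
    then show ?case by (intro L.Mat_entry[OF form])
  next
    case (add f h)
    then show ?case by (intro L.add)
  next
    case (mult f h)
    then show ?case by (intro L.mult)
  qed (rule L.const)
  then show ?thesis using p(2) act_ORep[OF n g line_ORep[OF V W]] by auto
qed

definition null_orbits :: "nat \<Rightarrow> (nat \<Rightarrow> nat) \<Rightarrow> ((nat \<Rightarrow> 'a::field mat) \<Rightarrow> 'a) \<Rightarrow> (nat \<Rightarrow> 'a mat) set" where
  "null_orbits n \<alpha> F = {V \<in> ORep n \<alpha>. \<forall>g\<in>GLgrp n \<alpha>. F (act n g V) = 0}"

lemma null_orbits_act:
  assumes n: "n \<ge> 1" and V: "V \<in> ORep n \<alpha>" and g: "g \<in> GLgrp n \<alpha>"
    and null: "act n g V \<in> null_orbits n \<alpha> F"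
  shows "V \<in> null_orbits n \<alpha> F"
proof -
  have "F (act n h V) = 0" if h: "h \<in> GLgrp n \<alpha>" for h
    by (rule act_factor[OF n h g V]) (use null in \<open>auto simp: null_orbits_def\<close>)
  then show ?thesis using V by (auto simp: null_orbits_def)
qed

text \<open>\<open>q\<close> encodes a generic condition that holds at \<open>W\<close>. If
  \<open>p\<close> is the invariant along a translated line, then p * q vanishes at every point of
  an infinite field, so p = 0 since q is not 0; its value at 0 belongs to \<open>V\<close>. This
  takes the place of passing to a closure.\<close>

lemma null_orbits_line:
  fixes F :: "(nat \<Rightarrow> 'a::field_char_0 mat) \<Rightarrow> 'a"
  assumes n: "n \<ge> 1" and F: "F \<in> OSI n \<alpha>" and V: "V \<in> ORep n \<alpha>" and W: "W \<in> ORep n \<alpha>"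
    and "poly q 1 \<noteq> 0" and good: "\<And>x. poly q x \<noteq> 0 \<Longrightarrow> line V W x \<in> null_orbits n \<alpha> F"
  shows "V \<in> null_orbits n \<alpha> F"
proof -
  have "F (act n g V) = 0" if g: "g \<in> GLgrp n \<alpha>" for g
  proof -
    obtain p where p: "\<And>x. F (act n g (line V W x)) = poly p x"
      using OSI_line_poly[OF n F V W g] by auto
    have "poly (p * q) x = 0" for x
      using good[of x] g p[of x] by (auto simp: null_orbits_def)
    then have "p * q = 0" by (simp only: poly_all_0_iff_0[symmetric]) simp
    moreover have "q \<noteq> 0" using assms(5) by auto
    ultimately have "p = 0" by simp
    then show ?thesis using p[of 0] line_0[OF V W] by simp
  qed
  then show ?thesis using V by (auto simp: null_orbits_def)
qed

section \<open>Normal form of a generic representation: arrows first, then the skew form\<close>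

abbreviation srep1 :: "nat \<Rightarrow> (nat \<Rightarrow> nat) \<Rightarrow> nat \<Rightarrow> 'a::field mat" where
  "srep1 n \<alpha> \<equiv> srep n \<alpha> (\<lambda>_. 1)"

lemma srep1_arrow:
  "1 \<le> i \<Longrightarrow> i < n \<Longrightarrow> r < \<alpha> (Suc i) \<Longrightarrow> s < \<alpha> i \<Longrightarrow> srep1 n \<alpha> i $$ (r, s) = (if r = s then 1 else 0)"
  by (simp add: srep_arrow)

lemma srep1_form: "r < \<alpha> n \<Longrightarrow> s < \<alpha> n \<Longrightarrow> srep1 n \<alpha> n $$ (r, s) = jform r s"
  by (simp add: srep_form)

lemma mult_srep1:
  assumes i: "1 \<le> i" "i < n" and X: "X \<in> carrier_mat m (\<alpha> (Suc i))" and rs: "r < m" "s < \<alpha> i"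
  shows "(X * srep1 n \<alpha> i) $$ (r, s) = (if s < \<alpha> (Suc i) then X $$ (r, s) else 0)"
proof -
  have "(X * srep1 n \<alpha> i) $$ (r, s) = (\<Sum>a<\<alpha> (Suc i). X $$ (r, a) * srep1 n \<alpha> i $$ (a, s))"
    by (rule index_mult_mat_sum[OF X _ rs]) (rule srep_carrier(1)[OF i])
  also have "\<dots> = (\<Sum>a<\<alpha> (Suc i). if a = s then X $$ (r, s) else 0)"
    using i rs by (intro sum.cong) (auto simp: srep1_arrow)
  finally show ?thesis by simp
qed

lemma srep1_mult:
  assumes "1 \<le> i" "i < n" "X \<in> carrier_mat (\<alpha> i) m" "r < \<alpha> (Suc i)" "s < m"
  shows "(srep1 n \<alpha> i * X) $$ (r, s) = (if r < \<alpha> i then X $$ (r, s) else 0)"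
  using srep_mult[OF assms] by simp

text \<open>Truncating an upper triangular matrix at vertex \<open>j\<close> to the levels that persist from
  vertex \<open>i\<close> to vertex \<open>j\<close> stabilises the standard arrows to the left of \<open>j\<close>.\<close>

lemma upper_triangular_stabiliser:
  fixes u :: "nat \<Rightarrow> nat \<Rightarrow> 'a::field_char_0"
  assumes j: "1 \<le> j" "j \<le> n"
    and upper: "\<And>r s. r < \<alpha> j \<Longrightarrow> s < r \<Longrightarrow> u r s = 0" and diag: "\<And>r. r < \<alpha> j \<Longrightarrow> u r r \<noteq> 0"
  obtains g where "g \<in> GLgrp n \<alpha>" "g j = mat (\<alpha> j) (\<alpha> j) (\<lambda>(r, s). u r s)"
    "\<And>i. j < i \<Longrightarrow> g i = 1\<^sub>m (\<alpha> i)"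
    "\<And>i. 1 \<le> i \<Longrightarrow> i < j \<Longrightarrow> g (Suc i) * srep1 n \<alpha> i = srep1 n \<alpha> i * g i"
proof
  define low where "low i r \<longleftrightarrow> i \<le> j \<and> (\<forall>l\<in>{i..j}. r < \<alpha> l)" for i r
  define g where "g i = mat (\<alpha> i) (\<alpha> i)
    (\<lambda>(r, s). if low i r \<and> low i s then u r s else if r = s then 1 else 0)" for i
  have low_j: "r < \<alpha> j" if "low i r" for i r using that by (auto simp: low_def)
  have low_Suc: "low i r \<longleftrightarrow> r < \<alpha> i \<and> low (Suc i) r" if "i < j" for i r
  proof -
    have "{i..j} = insert i {Suc i..j}" using that by auto
    then show ?thesis using that by (auto simp: low_def)
  qed
  have gc: "g i \<in> carrier_mat (\<alpha> i) (\<alpha> i)" for i by (simp add: g_def)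
  have "det (g i) \<noteq> 0" for i
  proof -
    have "det (g i) = prod_list (diag_mat (g i))"
      by (rule det_upper_triangular[OF _ gc]) (auto simp: g_def upper low_j intro!: upper_triangularI)
    also have "\<dots> \<noteq> 0" by (auto simp: prod_list_diag_prod g_def diag low_j)
    finally show ?thesis .
  qed
  then show "g \<in> GLgrp n \<alpha>" using gc by (auto simp: GLgrp_def)
  show "g j = mat (\<alpha> j) (\<alpha> j) (\<lambda>(r, s). u r s)" by (auto simp: g_def low_def)
  show "g i = 1\<^sub>m (\<alpha> i)" if "j < i" for i using that by (auto simp: g_def low_def)
  show "g (Suc i) * srep1 n \<alpha> i = srep1 n \<alpha> i * g i" if i: "1 \<le> i" "i < j" for i
  proof (rule eq_matI)
    have i': "1 \<le> i" "i < n" using i j by auto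
    note E = srep_carrier(1)[OF i', of \<alpha> "\<lambda>_. 1 :: 'a"]
    show "dim_row (g (Suc i) * srep1 n \<alpha> i) = dim_row (srep1 n \<alpha> i * g i)"
      "dim_col (g (Suc i) * srep1 n \<alpha> i) = dim_col (srep1 n \<alpha> i * g i)"
      using E gc[of i] gc[of "Suc i"] by auto
    fix r s assume "r < dim_row (srep1 n \<alpha> i * g i)" "s < dim_col (srep1 n \<alpha> i * g i)"
    then have rs: "r < \<alpha> (Suc i)" "s < \<alpha> i" using E gc[of i] by auto
    have "(if s < \<alpha> (Suc i) then g (Suc i) $$ (r, s) else 0) = (if r < \<alpha> i then g i $$ (r, s) else 0)"
    proof (cases "s < \<alpha> (Suc i)"; cases "r < \<alpha> i")
      assume "s < \<alpha> (Suc i)" "r < \<alpha> i"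
      then show ?thesis using rs by (simp add: g_def low_Suc[OF i(2)])
    next
      \<comment> \<open>This is where triangularity is needed: level \<open>s\<close> exists at both
        vertices, \<open>r\<close> only at \<open>Suc i\<close>, hence s < r.\<close>
      assume a: "s < \<alpha> (Suc i)" "\<not> r < \<alpha> i"
      then have "s < r" using rs by simp
      then show ?thesis using a rs low_j[of "Suc i" r] by (auto simp: g_def upper)
    next
      \<comment> \<open>Level \<open>s\<close> ends at \<open>i\<close>, so truncation has made
        column \<open>s\<close> of \<open>g i\<close> a unit vector.\<close>
      assume a: "\<not> s < \<alpha> (Suc i)" "r < \<alpha> i"
      then have "\<not> low i s" "r \<noteq> s" using rs i by (auto simp: low_def)
      then show ?thesis using a rs by (simp add: g_def)
    qed simp
    then show "(g (Suc i) * srep1 n \<alpha> i) $$ (r, s) = (srep1 n \<alpha> i * g i) $$ (r, s)"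
      using mult_srep1[where X = "g (Suc i)" and \<alpha> = \<alpha>, OF i' gc rs]
        srep1_mult[where X = "g i" and \<alpha> = \<alpha>, OF i' gc rs] by simp
  qed
qed

text \<open>What remains are the surplus columns of \<open>V j\<close> when \<alpha> j exceeds
  \<alpha> (Suc j). They are cleared by a base change at the source \<open>j\<close>, which is upper
  triangular and so extends to the left without disturbing the standard arrows; nothing changes to
  the right.\<close>

lemma null_orbits_arrow_unitriangular:
  fixes F :: "(nat \<Rightarrow> 'a::field_char_0 mat) \<Rightarrow> 'a"
  assumes n: "n \<ge> 1" and j: "1 \<le> j" "j < n"
    and hyp: "\<And>V. V \<in> ORep n \<alpha> \<Longrightarrow> (\<And>i. 1 \<le> i \<Longrightarrow> i \<le> j \<Longrightarrow> V i = srep1 n \<alpha> i) \<Longrightarrow> V \<in> null_orbits n \<alpha> F"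
    and V: "V \<in> ORep n \<alpha>" and std: "\<And>i. 1 \<le> i \<Longrightarrow> i < j \<Longrightarrow> V i = srep1 n \<alpha> i"
    and Vj: "\<And>r s. r < \<alpha> (Suc j) \<Longrightarrow> s < \<alpha> j \<Longrightarrow> s < \<alpha> (Suc j) \<Longrightarrow> V j $$ (r, s) = (if r = s then 1 else 0)"
  shows "V \<in> null_orbits n \<alpha> F"
proof -
  \<comment> \<open>The surplus columns form the upper right block, so that \<open>V j\<close> is
    the standard arrow times \<open>u\<close>.\<close>
  define u where "u r s = (if r < \<alpha> (Suc j) then V j $$ (r, s) else if r = s then 1 else 0)" for r s
  define W where "W = V(j := srep1 n \<alpha> j)"
  note Vjc = ORep_D(1)[OF V j]
  have W: "W \<in> ORep n \<alpha>"
    using V srep_carrier(1)[OF j, of \<alpha> "\<lambda>_. 1 :: 'a"] j by (auto simp: ORep_def W_def)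
  obtain g where g: "g \<in> GLgrp n \<alpha>" "g j = mat (\<alpha> j) (\<alpha> j) (\<lambda>(r, s). u r s)"
    "\<And>i. j < i \<Longrightarrow> g i = 1\<^sub>m (\<alpha> i)"
    "\<And>i. 1 \<le> i \<Longrightarrow> i < j \<Longrightarrow> g (Suc i) * srep1 n \<alpha> i = srep1 n \<alpha> i * g i"
    by (rule upper_triangular_stabiliser[of j n \<alpha> u]) (use j Vj in \<open>auto simp: u_def\<close>)
  have "act n g V = W"
  proof (rule act_eqI[OF n g(1) V W])
    fix i assume i: "1 \<le> i" "i < n"
    consider "i < j" | "i = j" | "j < i" by linarith
    then show "g (Suc i) * V i = W i * g i"
    proof cases
      case 1
      then show ?thesis using g(4)[OF i(1) 1] std[OF i(1) 1] by (simp add: W_def)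
    next
      case 2
      have gj: "g j \<in> carrier_mat (\<alpha> j) (\<alpha> j)" by (simp add: g(2))
      have "V j = srep1 n \<alpha> j * g j"
      proof (rule eq_matI)
        fix r s assume "r < dim_row (srep1 n \<alpha> j * g j)" "s < dim_col (srep1 n \<alpha> j * g j)"
        then have rs: "r < \<alpha> (Suc j)" "s < \<alpha> j"
          using srep_carrier(1)[OF j, of \<alpha> "\<lambda>_. 1 :: 'a"] gj by auto
        have "(srep1 n \<alpha> j * g j) $$ (r, s) = (if r < \<alpha> j then g j $$ (r, s) else 0)"
          using srep1_mult[where X = "g j" and \<alpha> = \<alpha>, OF j gj rs] .
        also have "\<dots> = V j $$ (r, s)"
          using rs Vj[OF rs] by (auto simp: g(2) u_def)
        finally show "V j $$ (r, s) = (srep1 n \<alpha> j * g j) $$ (r, s)" by simp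
      qed (use Vjc srep_carrier(1)[OF j, of \<alpha> "\<lambda>_. 1 :: 'a"] gj in auto)
      then show ?thesis using 2 g(3)[of "Suc j"] left_mult_one_mat[OF Vjc] by (simp add: W_def)
    next
      case 3
      then show ?thesis using g(3)[of i] g(3)[of "Suc i"] ORep_D(1)[OF V i]
        by (simp add: W_def left_mult_one_mat[of _ "\<alpha> (Suc i)" "\<alpha> i"] right_mult_one_mat[of _ "\<alpha> (Suc i)" "\<alpha> i"])
    qed
  next
    show "V n = transpose_mat (g n) * W n * g n"
      using g(3)[OF j(2)] j ORep_D(2)[OF V]
      by (simp add: W_def left_mult_one_mat[of _ "\<alpha> n" "\<alpha> n"] right_mult_one_mat[of _ "\<alpha> n" "\<alpha> n"])
  qed
  moreover have "W \<in> null_orbits n \<alpha> F"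
    by (rule hyp[OF W]) (use std in \<open>auto simp: W_def\<close>)
  ultimately show ?thesis using null_orbits_act[OF n V g(1)] by simp
qed

text \<open>A base change at the target \<open>Suc j\<close> turns the leading columns of a generic
  arrow into unit vectors. It affects otherwise only the next arrow, or the form, about which
  nothing is assumed yet.\<close>

lemma null_orbits_arrow:
  fixes F :: "(nat \<Rightarrow> 'a::field_char_0 mat) \<Rightarrow> 'a"
  assumes n: "n \<ge> 1" and F: "F \<in> OSI n \<alpha>" and j: "1 \<le> j" "j < n"
    and hyp: "\<And>V. V \<in> ORep n \<alpha> \<Longrightarrow> (\<And>i. 1 \<le> i \<Longrightarrow> i \<le> j \<Longrightarrow> V i = srep1 n \<alpha> i) \<Longrightarrow> V \<in> null_orbits n \<alpha> F"
    and V: "V \<in> ORep n \<alpha>" and std: "\<And>i. 1 \<le> i \<Longrightarrow> i < j \<Longrightarrow> V i = srep1 n \<alpha> i"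
  shows "V \<in> null_orbits n \<alpha> F"
proof -
  let ?L = "{f. \<exists>q. \<forall>x::'a. f x = poly q x}"
  interpret L: function_algebra UNIV ?L by (rule function_algebra_poly)
  define m where "m = \<alpha> (Suc j)"
  \<comment> \<open>Replacing arrow \<open>j\<close> alone keeps the arrows to its left standard
    along the whole line.\<close>
  define W where "W = V(j := srep1 n \<alpha> j)"
  \<comment> \<open>The leading columns of \<open>X\<close>, completed by unit vectors if there are
    fewer than \<open>m\<close>; for the standard arrow this is the identity, so its determinant is
    a generic condition.\<close>
  define h where "h X = mat m m (\<lambda>(r, s). if s < \<alpha> j then X $$ (r, s) else if r = s then 1 else 0)" for X :: "'a mat"
  have Vjc: "V j \<in> carrier_mat m (\<alpha> j)" using ORep_D(1)[OF V j] by (simp add: m_def)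
  have Wjc: "W j \<in> carrier_mat m (\<alpha> j)" using srep_carrier(1)[OF j, of \<alpha> "\<lambda>_. 1 :: 'a"] by (simp add: m_def W_def)
  have W: "W \<in> ORep n \<alpha>"
    using V srep_carrier(1)[OF j, of \<alpha> "\<lambda>_. 1 :: 'a"] j by (auto simp: ORep_def W_def)
  have hc: "h X \<in> carrier_mat m m" for X by (simp add: h_def)
  have "(\<lambda>x. h (line V W x j)) \<in> L.Mat m m"
  proof (rule L.Mat_I[OF hc])
    fix r s assume rs: "r < m" "s < m"
    show "(\<lambda>x. h (line V W x j) $$ (r, s)) \<in> ?L"
    proof (cases "s < \<alpha> j")
      case True
      then show ?thesis using line_entry_poly[where V = V and W = W and i = j, OF Vjc Wjc rs(1) True] rs
        by (simp add: h_def)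
    next
      case False
      then show ?thesis using L.const rs by (simp add: h_def)
    qed
  qed
  then obtain q where q: "\<And>x. det (h (line V W x j)) = poly q x" using L.det by blast
  have "h (line V W 1 j) = 1\<^sub>m m"
  proof (rule eq_matI)
    fix r s assume "r < dim_row (1\<^sub>m m)" "s < dim_col (1\<^sub>m m)"
    then have rs: "r < m" "s < m" by auto
    show "h (line V W 1 j) $$ (r, s) = 1\<^sub>m m $$ (r, s)"
      using rs j line_index[where V = V and W = W and i = j, OF Vjc Wjc rs(1), of s 1]
      by (auto simp: h_def W_def m_def srep1_arrow)
  qed (simp_all add: h_def)
  then have q1: "poly q 1 \<noteq> 0" using q[of 1] by simp
  show ?thesis
  proof (rule null_orbits_line[OF n F V W q1])
    fix x assume "poly q x \<noteq> 0"
    define X where "X = line V W x"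
    define H where "H = h (X j)"
    have detH: "det H \<noteq> 0" using \<open>poly q x \<noteq> 0\<close> q[of x] by (simp add: H_def X_def)
    have Hc: "H \<in> carrier_mat m m" using hc by (simp add: H_def)
    note Hi = mat_inv_carrier[OF Hc detH]
    have X: "X \<in> ORep n \<alpha>" unfolding X_def by (rule line_ORep[OF V W])
    have Xjc: "X j \<in> carrier_mat m (\<alpha> j)" using ORep_D(1)[OF X j] by (simp add: m_def)
    have Xi: "X i = V i" if "1 \<le> i" "i < j" for i
      unfolding X_def by (rule line_eq[OF _ ORep_D(1)[OF V]]) (use that j in \<open>auto simp: W_def\<close>)
    define g where "g i = (if i = Suc j then mat_inv H else 1\<^sub>m (\<alpha> i))" for i
    have g: "g \<in> GLgrp n \<alpha>"
      using Hi detH det_mat_inv[OF Hc detH] by (auto simp: GLgrp_def g_def m_def)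
    define Y where "Y = act n g X"
    have Y: "Y \<in> ORep n \<alpha>" unfolding Y_def by (rule act_ORep[OF n g X])
    have "Y \<in> null_orbits n \<alpha> F"
    proof (rule null_orbits_arrow_unitriangular[OF n j hyp Y])
      fix i assume i: "1 \<le> i" "i < j"
      then have i': "1 \<le> i" "i < n" using j by auto
      have "g (Suc i) * X i = Y i * g i" unfolding Y_def by (rule act_D(1)[OF n g X i'])
      then show "Y i = srep1 n \<alpha> i"
        using i Xi[OF i] std[OF i] ORep_D(1)[OF X i'] ORep_D(1)[OF Y i']
        by (simp add: g_def left_mult_one_mat[of _ "\<alpha> (Suc i)" "\<alpha> i"] right_mult_one_mat[of _ "\<alpha> (Suc i)" "\<alpha> i"])
    next
      fix r s assume rs: "r < \<alpha> (Suc j)" "s < \<alpha> j" "s < \<alpha> (Suc j)"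
      have "g (Suc j) * X j = Y j * g j" unfolding Y_def by (rule act_D(1)[OF n g X j])
      then have "Y j = mat_inv H * X j"
        using ORep_D(1)[OF Y j] by (simp add: g_def right_mult_one_mat[of _ "\<alpha> (Suc j)" "\<alpha> j"])
      then have "Y j $$ (r, s) = (\<Sum>a<m. mat_inv H $$ (r, a) * X j $$ (a, s))"
        using index_mult_mat_sum[OF Hi Xjc] rs by (simp add: m_def)
      also have "\<dots> = (\<Sum>a<m. mat_inv H $$ (r, a) * H $$ (a, s))"
        using rs by (intro sum.cong) (auto simp: H_def h_def m_def)
      also have "\<dots> = (mat_inv H * H) $$ (r, s)"
        using index_mult_mat_sum[OF Hi Hc] rs by (simp add: m_def)
      also have "\<dots> = (if r = s then 1 else 0)"
        using mat_inv_left[OF Hc detH] rs by (simp add: m_def)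
      finally show "Y j $$ (r, s) = (if r = s then 1 else 0)" .
    qed
    then show "line V W x \<in> null_orbits n \<alpha> F"
      using null_orbits_act[OF n X g] by (simp add: Y_def X_def)
  qed
qed

text \<open>One step of symplectic Gram--Schmidt: \<open>u\<close> replaces the coordinates \<open>2k\<close> and \<open>2k + 1\<close> by the
  two linear forms read off from the corresponding rows of \<open>V n\<close>, which splits off a hyperbolic plane.\<close>

lemma null_orbits_form_step:
  fixes F :: "(nat \<Rightarrow> 'a::field_char_0 mat) \<Rightarrow> 'a"
  assumes n: "n \<ge> 1" and k: "2 * k + 1 < \<alpha> n"
    and hyp: "\<And>V. V \<in> ORep n \<alpha> \<Longrightarrow> (\<And>i. 1 \<le> i \<Longrightarrow> i < n \<Longrightarrow> V i = srep1 n \<alpha> i) \<Longrightarrow>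
      (\<And>r s. r < \<alpha> n \<Longrightarrow> s < \<alpha> n \<Longrightarrow> r < 2 * Suc k \<or> s < 2 * Suc k \<Longrightarrow> V n $$ (r, s) = jform r s) \<Longrightarrow>
      V \<in> null_orbits n \<alpha> F"
    and V: "V \<in> ORep n \<alpha>" and std: "\<And>i. 1 \<le> i \<Longrightarrow> i < n \<Longrightarrow> V i = srep1 n \<alpha> i"
    and J: "\<And>r s. r < \<alpha> n \<Longrightarrow> s < \<alpha> n \<Longrightarrow> r < 2 * k \<or> s < 2 * k \<Longrightarrow> V n $$ (r, s) = jform r s"
    and pivot: "V n $$ (2 * k, 2 * k + 1) \<noteq> 0"
  shows "V \<in> null_orbits n \<alpha> F"
proof -
  define d where "d = \<alpha> n"
  define p where "p = 2 * k"
  define q where "q = 2 * k + 1"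
  define v where "v r s = V n $$ (r, s)" for r s
  define a where "a = v p q"
  have pq: "p < d" "q < d" "p < q" "p \<noteq> q" and q_Suc: "q = Suc p" using k by (auto simp: p_def q_def d_def)
  have a: "a \<noteq> 0" using pivot by (simp add: a_def v_def p_def q_def)
  have skew: "v r s = - v s r" if "r < d" "s < d" for r s
    unfolding v_def by (rule ORep_D(4)[OF V]) (use that in \<open>auto simp: d_def\<close>)
  have diag0: "v r r = 0" if "r < d" for r using skew[OF that that] by simp
  have vJ: "v r s = jform r s" if "r < d" "s < d" "r < p \<or> s < p" for r s
    using J that by (simp add: v_def d_def p_def)
  have jform_low: "jform r s = (0::'a)" "jform s r = (0::'a)" if "r < p" "p \<le> s" for r s
    using that by (auto simp: jform_def p_def)
  \<comment> \<open>Sign and factor in row \<open>p\<close> make the block of \<open>u\<close> at p,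
    q diagonal with entries 1 and \<open>a\<close>. To the left of \<open>p\<close> both rows
    vanish, because the planes already split off are orthogonal to the rest; so \<open>u\<close> is
    upper triangular and extends to the arrows.\<close>
  define u where "u r s = (if r = p then v s q / a else if r = q then v p s else if r = s then 1 else 0)" for r s
  \<comment> \<open>Beyond the new plane, \<open>w\<close> is \<open>v\<close> minus the
    contribution of that plane; the aim is that \<open>v\<close> be the congruence of
    \<open>w\<close> by \<open>u\<close>.\<close>
  define w where "w r s = (if r < 2 * Suc k \<or> s < 2 * Suc k then jform r s
    else v r s - (u p r * u q s - u q r * u p s))" for r s
  have lt2: "r < Suc (Suc (2 * k)) \<longleftrightarrow> r < p \<or> r = p \<or> r = q" for r by (auto simp: p_def q_def)
  have w_skew: "w r s = - w s r" if "r < d" "s < d" for r s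
    using skew[OF that] jform_skew[of r s, where ?'a = 'a] by (auto simp: w_def algebra_simps)
  have up: "u p s = v s q / a" "u q s = v p s" for s using pq by (auto simp: u_def)
  have u_low: "u p s = 0" "u q s = 0" if "s < p" for s
    using that pq vJ[of s q] vJ[of p s] jform_low(1)[of s q] jform_low(2)[of s p] by (simp_all add: up)
  have u_pivot: "u p p = 1" "u p q = 0" "u q p = 0" "u q q = a"
    using a pq diag0 by (auto simp: up a_def)
  define W where "W = V(n := mat d d (\<lambda>(r, s). w r s))"
  have W: "W \<in> ORep n \<alpha>"
  proof (rule ORep_I)
    show "W n $$ (r, s) = - W n $$ (s, r)" if "r < \<alpha> n" "s < \<alpha> n" for r s
      using that w_skew[of r s] by (simp add: W_def d_def)
  qed (use ORep_D[OF V] n in \<open>auto simp: W_def d_def\<close>)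
  obtain g where g: "g \<in> GLgrp n \<alpha>" "g n = mat d d (\<lambda>(r, s). u r s)"
    "\<And>i. 1 \<le> i \<Longrightarrow> i < n \<Longrightarrow> g (Suc i) * srep1 n \<alpha> i = srep1 n \<alpha> i * g i"
  proof (rule upper_triangular_stabiliser[of n n \<alpha> u])
    fix r s assume "r < \<alpha> n" "s < r"
    moreover from this have "r \<noteq> p" "r = q \<Longrightarrow> s = p" if "\<not> s < p" using that q_Suc by auto
    ultimately show "u r s = 0" using u_low[of s] u_pivot(3) by (cases "s < p") (auto simp: u_def)
  next
    fix r assume "r < \<alpha> n"
    then show "u r r \<noteq> 0" using u_pivot(1,4) a by (cases "r = p \<or> r = q") (auto, simp add: u_def)
  qed (use n d_def that in auto)
  have "even p" by (simp add: p_def)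
  then have jform_p: "jform p b = (if b = q then 1 else 0 :: 'a)"
    and jform_q: "jform q b = (if b = p then - 1 else 0 :: 'a)" for b
    unfolding q_Suc jform_def by auto
  have wp: "w p b = (if b = q then 1 else 0)" "w q b = (if b = p then - 1 else 0)" for b
    by (simp_all add: w_def lt2 jform_p jform_q)
  have wother: "w r p = 0" "w r q = 0" if "r \<noteq> p" "r \<noteq> q" for r
    using that by (simp_all add: w_def lt2 jform_skew[of r p] jform_skew[of r q] jform_p jform_q)
  have wu: "(\<Sum>b<d. w r b * u b s) = (if r = p then u q s else if r = q then - u p s else w r s)"
    if rs: "r < d" "s < d" for r s
  proof -
    consider "r = p" | "r = q" | "r \<noteq> p" "r \<noteq> q" by blast
    then show ?thesis
    proof cases
      case 1
      then have "(\<Sum>b<d. w r b * u b s) = (\<Sum>b<d. if b = q then u q s else 0)"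
        by (intro sum.cong) (auto simp: wp)
      then show ?thesis using 1 pq by simp
    next
      case 2
      then have "(\<Sum>b<d. w r b * u b s) = (\<Sum>b<d. if b = p then - u p s else 0)"
        by (intro sum.cong) (auto simp: wp)
      then show ?thesis using 2 pq by simp
    next
      case 3
      have "w r b * u b s = (if b = s then w r s else 0)" for b
        using wother[OF 3] by (cases "b = p \<or> b = q") (auto simp: u_def)
      then show ?thesis using 3 rs by simp
    qed
  qed
  \<comment> \<open>Outside rows \<open>p\<close> and \<open>q\<close> the matrix \<open>u\<close>
    is the identity, so a sum over a column has at most three terms.\<close>
  have split: "(\<Sum>b<d. u b r * f b) = u p r * f p + u q r * f q + (if r = p \<or> r = q then 0 else f r)"
    if "r < d" for r and f :: "nat \<Rightarrow> 'a"
  proof -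
    have "(\<Sum>b<d. u b r * f b) = (\<Sum>b<d. (if b = p then u p r * f p else 0) + (if b = q then u q r * f q else 0)
        + (if b = r then (if r = p \<or> r = q then 0 else f r) else 0))"
      using pq by (intro sum.cong) (auto simp: u_def)
    also have "\<dots> = u p r * f p + u q r * f q + (if r = p \<or> r = q then 0 else f r)"
      using pq that by (simp add: sum.distrib)
    finally show ?thesis .
  qed
  have gc: "g n \<in> carrier_mat d d" by (simp add: g(2))
  have Wn: "W n \<in> carrier_mat d d" by (simp add: W_def)
  have Vn: "V n = transpose_mat (g n) * (W n * g n)"
  proof (rule eq_matI)
    fix r s assume "r < dim_row (transpose_mat (g n) * (W n * g n))" "s < dim_col (transpose_mat (g n) * (W n * g n))"
    then have rs: "r < d" "s < d" using gc by auto
    have Wg: "(W n * g n) $$ (b, s) = (if b = p then u q s else if b = q then - u p s else w b s)" if "b < d" for b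
    proof -
      have "(W n * g n) $$ (b, s) = (\<Sum>c<d. w b c * u c s)"
        unfolding index_mult_mat_sum[OF Wn gc that rs(2)]
        using that rs by (intro sum.cong) (auto simp: W_def g(2))
      then show ?thesis using wu[OF that rs(2)] by simp
    qed
    have "(transpose_mat (g n) * (W n * g n)) $$ (r, s)
        = (\<Sum>b<d. transpose_mat (g n) $$ (r, b) * (W n * g n) $$ (b, s))"
      using gc Wn rs by (intro index_mult_mat_sum) auto
    also have "\<dots> = (\<Sum>b<d. u b r * (if b = p then u q s else if b = q then - u p s else w b s))"
      using rs gc Wg by (intro sum.cong arg_cong2[of _ _ _ _ "(*)"]) (auto simp: g(2))
    also have "\<dots> = u p r * u q s - u q r * u p s + (if r = p \<or> r = q then 0 else w r s)"
      using split[OF rs(1)] pq by simp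
    also have "\<dots> = v r s"
    proof -
      consider "r < p" | "r = p" | "r = q" | "r > q" "s < p" | "r > q" "s = p" | "r > q" "s = q" | "r > q" "s > q"
        using q_Suc by linarith
      then show ?thesis
      proof cases
        case 1
        then show ?thesis using u_low[OF 1] vJ[OF rs] pq by (simp add: w_def lt2)
      next
        case 2
        then show ?thesis using up(2)[of s] by (simp add: u_pivot)
      next
        case 3
        then show ?thesis using a skew[OF rs] up(1)[of s] by (simp add: u_pivot)
      next
        case 4
        then show ?thesis using u_low[OF 4(2)] vJ[OF rs] pq by (simp add: w_def lt2)
      next
        case 5
        then show ?thesis using skew[OF rs] pq wother(1)[of r] up(2)[of r] by (simp add: u_pivot)
      next
        case 6
        then show ?thesis using a pq wother(2)[of r] up(1)[of r] by (simp add: u_pivot)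
      next
        case 7
        then show ?thesis using pq by (simp add: w_def lt2)
      qed
    qed
    finally show "V n $$ (r, s) = (transpose_mat (g n) * (W n * g n)) $$ (r, s)" by (simp add: v_def)
  qed (use ORep_D(2)[OF V] gc in \<open>auto simp: d_def\<close>)
  have "act n g V = W"
  proof (rule act_eqI[OF n g(1) V W])
    show "g (Suc i) * V i = W i * g i" if "1 \<le> i" "i < n" for i
      using that g(3)[OF that] std[OF that] by (simp add: W_def)
    show "V n = transpose_mat (g n) * W n * g n"
      using Vn gc Wn by (simp add: assoc_mult_mat[of _ d d _ d _ d])
  qed
  moreover have "W \<in> null_orbits n \<alpha> F"
  proof (rule hyp[OF W])
    show "W i = srep1 n \<alpha> i" if "1 \<le> i" "i < n" for i using std that by (simp add: W_def)
    show "W n $$ (r, s) = jform r s" if "r < \<alpha> n" "s < \<alpha> n" "r < 2 * Suc k \<or> s < 2 * Suc k" for r s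
      using that by (auto simp: W_def w_def d_def)
  qed
  ultimately show ?thesis using null_orbits_act[OF n V g(1)] by simp
qed

text \<open>When no pivot pair is left, the remaining block has size at most one and is 0 by
  skew-symmetry. Otherwise the line to the standard representation preserves the planes already
  split off, and its pivot entry a + x (1 - a) equals 1 at x = 1.\<close>

lemma null_orbits_form:
  fixes F :: "(nat \<Rightarrow> 'a::field_char_0 mat) \<Rightarrow> 'a"
  assumes n: "n \<ge> 1" and F: "F \<in> OSI n \<alpha>" and base: "srep1 n \<alpha> \<in> null_orbits n \<alpha> F"
    and V: "V \<in> ORep n \<alpha>" and std: "\<And>i. 1 \<le> i \<Longrightarrow> i < n \<Longrightarrow> V i = srep1 n \<alpha> i"
    and J: "\<And>r s. r < \<alpha> n \<Longrightarrow> s < \<alpha> n \<Longrightarrow> r < 2 * k \<or> s < 2 * k \<Longrightarrow> V n $$ (r, s) = jform r s"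
  shows "V \<in> null_orbits n \<alpha> F"
  using V std J
proof (induction "\<alpha> n - 2 * k" arbitrary: k V rule: less_induct)
  case less
  note V = less.prems(1) and std = less.prems(2) and J = less.prems(3)
  show ?case
  proof (cases "2 * k + 1 < \<alpha> n")
    case False
    have "V = srep1 n \<alpha>"
    proof
      fix i
      consider "1 \<le> i" "i < n" | "i = n" | "i \<notin> {1..n}" by fastforce
      then show "V i = srep1 n \<alpha> i"
      proof cases
        case 1
        then show ?thesis by (rule std)
      next
        case 2
        have "V n = srep1 n \<alpha> n"
        proof (rule eq_matI)
          fix r s assume "r < dim_row (srep1 n \<alpha> n :: 'a mat)" "s < dim_col (srep1 n \<alpha> n :: 'a mat)"
          then have rs: "r < \<alpha> n" "s < \<alpha> n" using srep_carrier(2)[of n \<alpha> "\<lambda>_. 1 :: 'a"] by auto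
          show "V n $$ (r, s) = srep1 n \<alpha> n $$ (r, s)"
          proof (cases "r < 2 * k \<or> s < 2 * k")
            case True
            then show ?thesis using J[OF rs True] rs by (simp add: srep1_form)
          next
            case high: False
            then have "r = s" using False rs by linarith
            then show ?thesis using ORep_D(4)[OF V rs] rs by (simp add: srep1_form jform_def)
          qed
        qed (use ORep_D(2)[OF V] srep_carrier(2)[of n \<alpha> "\<lambda>_. 1 :: 'a"] in auto)
        then show ?thesis using 2 by simp
      next
        case 3
        then show ?thesis using ORep_D(3)[OF V 3] ORep_D(3)[OF srep_ORep[OF n, of \<alpha> "\<lambda>_. 1 :: 'a"] 3] by simp
      qed
    qed
    then show ?thesis using base by simp
  next
    case True
    define a where "a = V n $$ (2 * k, 2 * k + 1)"
    note E = srep_ORep[OF n, of \<alpha> "\<lambda>_. 1 :: 'a"]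
    note idx = line_index[of V n "\<alpha> n" "\<alpha> n" "srep1 n \<alpha>", OF ORep_D(2)[OF V] ORep_D(2)[OF E]]
    have q1: "poly [:a, 1 - a:] 1 \<noteq> 0" by simp
    show ?thesis
    proof (rule null_orbits_line[OF n F V E q1])
      fix x assume x: "poly [:a, 1 - a:] x \<noteq> 0"
      let ?X = "line V (srep1 n \<alpha>) x"
      show "?X \<in> null_orbits n \<alpha> F"
      proof (rule null_orbits_form_step[where k = k, OF n True _ line_ORep[OF V E]])
        fix U :: "nat \<Rightarrow> 'a mat"
        assume "U \<in> ORep n \<alpha>" "\<And>i. 1 \<le> i \<Longrightarrow> i < n \<Longrightarrow> U i = srep1 n \<alpha> i"
          "\<And>r s. r < \<alpha> n \<Longrightarrow> s < \<alpha> n \<Longrightarrow> r < 2 * Suc k \<or> s < 2 * Suc k \<Longrightarrow> U n $$ (r, s) = jform r s"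
        then show "U \<in> null_orbits n \<alpha> F" using True by (intro less.hyps[of "Suc k" U]) auto
      next
        fix i assume i: "1 \<le> i" "i < n"
        show "?X i = srep1 n \<alpha> i" using line_eq[of V i "srep1 n \<alpha>", OF std[OF i] ORep_D(1)[OF V i]] std[OF i] by simp
      next
        fix r s assume rs: "r < \<alpha> n" "s < \<alpha> n" "r < 2 * k \<or> s < 2 * k"
        then show "?X n $$ (r, s) = jform r s" using idx[OF rs(1,2)] J[OF rs] by (simp add: srep1_form)
      next
        show "?X n $$ (2 * k, 2 * k + 1) \<noteq> 0"
          using idx[of "2 * k" "2 * k + 1" x] True x by (simp add: srep1_form a_def jform_def)
      qed
    qed
  qed
qed

text \<open>Downward induction on the first vertex \<open>j\<close> whose arrow is not assumed
  standard: at \<open>j = n\<close> only the form is arbitrary, at \<open>j = 1\<close> nothing is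
  assumed.\<close>

lemma OSI_vanish:
  fixes F :: "(nat \<Rightarrow> 'a::field_char_0 mat) \<Rightarrow> 'a"
  assumes n: "n \<ge> 1" and F: "F \<in> OSI n \<alpha>"
    and zero: "\<And>t. (\<And>j. \<not> free_vertex n \<alpha> j \<Longrightarrow> t j = 1) \<Longrightarrow> F (srep n \<alpha> t) = 0"
    and V: "V \<in> ORep n \<alpha>"
  shows "F V = 0"
proof -
  have base: "srep1 n \<alpha> \<in> null_orbits n \<alpha> F"
    using OSI_vanish_open_orbit[OF n F zero] srep_ORep[OF n] by (auto simp: null_orbits_def)
  have "\<forall>V\<in>ORep n \<alpha>. (\<forall>i. 1 \<le> i \<and> i < j \<longrightarrow> V i = srep1 n \<alpha> i) \<longrightarrow> V \<in> null_orbits n \<alpha> F"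
    if "1 \<le> j" "j \<le> n" for j
    using that(2,1)
  proof (induction rule: inc_induct)
    case base
    show ?case using null_orbits_form[OF n F \<open>srep1 n \<alpha> \<in> _\<close>, of _ 0] by auto
  next
    case (step j)
    have j: "1 \<le> j" "j < n" using step by auto
    have "U \<in> null_orbits n \<alpha> F"
      if "U \<in> ORep n \<alpha>" "\<And>i. 1 \<le> i \<Longrightarrow> i \<le> j \<Longrightarrow> U i = srep1 n \<alpha> i" for U
      using step.IH j that by (simp add: less_Suc_eq_le)
    then show ?case by (blast intro: null_orbits_arrow[OF n F j])
  qed
  from this[of 1] have null: "V \<in> null_orbits n \<alpha> F" using n V by auto
  have "(\<lambda>i. 1\<^sub>m (\<alpha> i)) \<in> GLgrp n \<alpha>" by (auto simp: GLgrp_def)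
  then have "F (act n (\<lambda>i. 1\<^sub>m (\<alpha> i)) V) = 0" using null by (auto simp: null_orbits_def)
  moreover have "act n (\<lambda>i. 1\<^sub>m (\<alpha> i)) V = V"
  proof (rule act_eqI[OF n _ V V])
    show "1\<^sub>m (\<alpha> (Suc i)) * V i = V i * 1\<^sub>m (\<alpha> i)" if "1 \<le> i" "i < n" for i
      using ORep_D(1)[OF V that] by simp
    show "V n = transpose_mat (1\<^sub>m (\<alpha> n)) * V n * 1\<^sub>m (\<alpha> n)"
      using ORep_D(2)[OF V] by simp
  qed (auto simp: GLgrp_def)
  ultimately show ?thesis by simp
qed

theorem theorem2p5:
  fixes n :: nat and \<alpha> :: "nat \<Rightarrow> nat"
  assumes "n \<ge> 1"
  shows "(generators n \<alpha> :: ((nat \<Rightarrow> 'a::{alg_closed_field, field_char_0} mat) \<Rightarrow> 'a) set)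
           \<subseteq> OSI n \<alpha>
    \<and> (\<forall>f \<in> (OSI n \<alpha> :: ((nat \<Rightarrow> 'a mat) \<Rightarrow> 'a) set).
         \<exists>h \<in> alg_gen (generators n \<alpha>). \<forall>V \<in> ORep n \<alpha>. f V = h V)"
proof (intro conjI ballI)
  interpret O: function_algebra "ORep n \<alpha>" "OSI n \<alpha> :: ((nat \<Rightarrow> 'a mat) \<Rightarrow> 'a) set"
    by (rule function_algebra_OSI[OF assms])
  show gens: "(generators n \<alpha> :: ((nat \<Rightarrow> 'a mat) \<Rightarrow> 'a) set) \<subseteq> OSI n \<alpha>"
    by (rule generators_subset_OSI[OF assms])
  fix f :: "(nat \<Rightarrow> 'a mat) \<Rightarrow> 'a" assume f: "f \<in> OSI n \<alpha>"
  then obtain p where p: "p \<in> poly_fun n \<alpha>" "\<And>V. V \<in> ORep n \<alpha> \<Longrightarrow> f V = p V"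
    by (auto simp: OSI_def)
  from poly_fun_on_section[OF assms p(1)] obtain h where h: "h \<in> alg_gen (generators n \<alpha>)"
    "\<And>t. (\<And>j. \<not> free_vertex n \<alpha> j \<Longrightarrow> t j = 1) \<Longrightarrow> p (srep n \<alpha> t) = h (srep n \<alpha> t)"
    by auto
  \<comment> \<open>Being invariant as well, \<open>h\<close> can be subtracted; the difference is
    an invariant that vanishes on the section.\<close>
  have "h \<in> OSI n \<alpha>" using alg_gen_subset[OF O.function_algebra_axioms gens] h(1) by blast
  then have "(\<lambda>V. f V - h V) \<in> OSI n \<alpha>" by (rule O.diff[OF f])
  then have "f V - h V = 0" if "V \<in> ORep n \<alpha>" for V
    by (rule OSI_vanish[OF assms _ _ that]) (simp add: p(2)[OF srep_ORep[OF assms]] h(2))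
  then show "\<exists>h \<in> alg_gen (generators n \<alpha>). \<forall>V \<in> ORep n \<alpha>. f V = h V"
    using h(1) by (intro bexI[of _ h]) auto
qed

end
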